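(* The function $R_q$ is $m_q$-integrable, and $(\mathscr T^q,m_q,\mathrm{BCZ}_q)$ with roof function $R_q$ is a Poincaré cross section for the horocycle flow $(X_q,\mu_q,h)$, in the following sense. Let $Y=\{((a,b),s):(a,b)\in\mathscr T^q,\ 0\le s<R_q(a,b)\}$ with the suspension flow $\phi_t$ (move $s$ at unit speed, identifying $((a,b),R_q(a,b))$ with $(\mathrm{BCZ}_q(a,b),0)$), and the probability measure $\nu=\frac{1}{m_q(R_q)}\,dm_q\,ds$. Then the map $\Phi:Y\to X_q$, $\Phi((a,b),s)=h_sg_{a,b}G_q$, is a bijection onto an $h$-invariant subset of $X_q$ of full $\mu_q$-measure, satisfies $\Phi\circ\phi_t=h_t\circ\Phi$ for all $t\ge0$, and $\Phi_*\nu=\mu_q$.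
   Context: Fix an integer $q\ge3$, let $\lambda_q=2\cos(\pi/q)$, and let $G_q\subset \mathrm{SL}(2,\mathbb R)$ be the Hecke triangle group generated by $S=\begin{pmatrix}0&-1\\1&0\end{pmatrix}$ and $T_q=\begin{pmatrix}1&\lambda_q\\0&1\end{pmatrix}$ (a lattice), acting linearly on $\mathbb R^2$; $\Lambda_q=G_q(1,0)^T$. $X_q=\mathrm{SL}(2,\mathbb R)/G_q$ with $\mathrm{SL}(2,\mathbb R)$-invariant probability measure $\mu_q$, and horocycle flow $h_t(gG_q)=h_tgG_q$ where $h_s=\begin{pmatrix}1&0\\-s&1\end{pmatrix}$. $g_{a,b}=\begin{pmatrix}a&b\\0&a^{-1}\end{pmatrix}$; $S_1=\{(x,y)^T:0<x\le1\}$. $\mathscr T^q=\{(a,b):0<a\le1,\ 1-\lambda_qa<b\le1\}$ with Lebesgue probability measure $m_q=\frac{2}{\lambda_q}\,da\,db$; $m_q(R_q)=\int R_q\,dm_q$. For $(a,b)\in\mathscr T^q$, $R_q(a,b)$ is the smallest positive slope among the vectors of $g_{a,b}\Lambda_q\cap S_1=\{g_{a,b}\mathbf v:\mathbf v\in\Lambda_q\}\cap S_1$ (which exists), and $\mathrm{BCZ}_q(a,b)$ is the unique $(c,d)\in\mathscr T^q$ with $h_{R_q(a,b)}g_{a,b}\Lambda_q=g_{c,d}\Lambda_q$ (such a point exists and is unique). *)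

theory Defs
  imports "HOL-Probability.Probability"
begin

type_synonym mat2 = "real^2^2"
type_synonym vec2 = "real^2"

definition mat2 :: "real \<Rightarrow> real \<Rightarrow> real \<Rightarrow> real \<Rightarrow> mat2" where
  "mat2 a b c d = vector [vector [a, b], vector [c, d]]"

definition SL2 :: "mat2 set" where
  "SL2 = {A. det A = 1}"

definition lambda_q :: "nat \<Rightarrow> real" where
  "lambda_q q = 2 * cos (pi / real q)"

definition Smat :: mat2 where "Smat = mat2 0 (-1) 1 0"
definition Tmat :: "nat \<Rightarrow> mat2" where "Tmat q = mat2 1 (lambda_q q) 0 1"

inductive_set Gq :: "nat \<Rightarrow> mat2 set" for q :: nat where
  Gq_one: "mat 1 \<in> Gq q"
| Gq_S: "A \<in> Gq q \<Longrightarrow> A ** Smat \<in> Gq q"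
| Gq_Sinv: "A \<in> Gq q \<Longrightarrow> A ** matrix_inv Smat \<in> Gq q"
| Gq_T: "A \<in> Gq q \<Longrightarrow> A ** Tmat q \<in> Gq q"
| Gq_Tinv: "A \<in> Gq q \<Longrightarrow> A ** matrix_inv (Tmat q) \<in> Gq q"

definition Lambda_q :: "nat \<Rightarrow> vec2 set" where
  "Lambda_q q = {\<gamma> *v vector [1, 0] | \<gamma>. \<gamma> \<in> Gq q}"

definition coset :: "nat \<Rightarrow> mat2 \<Rightarrow> mat2 set" where
  "coset q g = (\<lambda>\<gamma>. g ** \<gamma>) ` Gq q"

definition Xq :: "nat \<Rightarrow> mat2 set set" where
  "Xq q = coset q ` SL2"

definition lmul :: "mat2 \<Rightarrow> mat2 set \<Rightarrow> mat2 set" where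
  "lmul g x = (\<lambda>m. g ** m) ` x"

definition Xq_space :: "nat \<Rightarrow> mat2 set measure" where
  "Xq_space q = sigma (Xq q) {A. A \<subseteq> Xq q \<and> {g \<in> SL2. coset q g \<in> A} \<in> sets borel}"

definition mu_q :: "nat \<Rightarrow> mat2 set measure" where
  "mu_q q = (THE \<mu>. sets \<mu> = sets (Xq_space q) \<and> prob_space \<mu> \<and>
       (\<forall>g\<in>SL2. \<forall>A\<in>sets \<mu>. emeasure \<mu> (lmul g ` A) = emeasure \<mu> A))"

definition hmat :: "real \<Rightarrow> mat2" where "hmat s = mat2 1 0 (-s) 1"
definition gmat :: "real \<Rightarrow> real \<Rightarrow> mat2" where "gmat a b = mat2 a b 0 (1 / a)"

definition hflow :: "real \<Rightarrow> mat2 set \<Rightarrow> mat2 set" where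
  "hflow t x = lmul (hmat t) x"

definition S1 :: "vec2 set" where "S1 = {v. 0 < v $ 1 \<and> v $ 1 \<le> 1}"

definition BCZ_triangle :: "nat \<Rightarrow> (real \<times> real) set" where
  "BCZ_triangle q = {(a, b). 0 < a \<and> a \<le> 1 \<and> 1 - lambda_q q * a < b \<and> b \<le> 1}"

definition mq :: "nat \<Rightarrow> (real \<times> real) measure" where
  "mq q = density lborel (\<lambda>p. ennreal (2 / lambda_q q) * indicator (BCZ_triangle q) p)"

definition glat :: "nat \<Rightarrow> mat2 \<Rightarrow> vec2 set" where
  "glat q g = (\<lambda>v. g *v v) ` Lambda_q q"

definition slope :: "vec2 \<Rightarrow> real" where "slope v = v $ 2 / v $ 1"

definition Rq :: "nat \<Rightarrow> real \<times> real \<Rightarrow> real" where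
  "Rq q p = (LEAST r. r \<in> {slope v | v. v \<in> glat q (gmat (fst p) (snd p)) \<inter> S1 \<and> 0 < slope v})"

definition BCZ :: "nat \<Rightarrow> real \<times> real \<Rightarrow> real \<times> real" where
  "BCZ q p = (THE p'. p' \<in> BCZ_triangle q \<and>
      glat q (hmat (Rq q p) ** gmat (fst p) (snd p)) = glat q (gmat (fst p') (snd p')))"

definition Yq :: "nat \<Rightarrow> ((real \<times> real) \<times> real) set" where
  "Yq q = {(p, s). p \<in> BCZ_triangle q \<and> 0 \<le> s \<and> s < Rq q p}"

definition ret :: "nat \<Rightarrow> real \<times> real \<Rightarrow> nat \<Rightarrow> real" where
  "ret q p n = (\<Sum>k<n. Rq q ((BCZ q ^^ k) p))"

text \<open>Suspension flow (for t \<ge> 0).\<close>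
definition susp_flow :: "nat \<Rightarrow> real \<Rightarrow> (real \<times> real) \<times> real \<Rightarrow> (real \<times> real) \<times> real" where
  "susp_flow q t y = (let p = fst y; s = snd y;
      n = (THE n. ret q p n \<le> s + t \<and> s + t < ret q p (Suc n))
    in ((BCZ q ^^ n) p, s + t - ret q p n))"

definition mqR :: "nat \<Rightarrow> real" where
  "mqR q = integral\<^sup>L (mq q) (Rq q)"

definition nu_q :: "nat \<Rightarrow> ((real \<times> real) \<times> real) measure" where
  "nu_q q = density lborel
     (\<lambda>y. ennreal (2 / (lambda_q q * mqR q)) * indicator (Yq q) y)"

definition Phi :: "nat \<Rightarrow> (real \<times> real) \<times> real \<Rightarrow> mat2 set" where
  "Phi q y = coset q (hmat (snd y) ** gmat (fst (fst y)) (snd (fst y)))"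

end

theory Submission
  imports Defs
begin

text \<open>
  Writing an element of the group as a word in the nonnegative matrices \<open>U\<^sup>k T\<close> with \<open>U = T S\<close>
  shows that every matrix entry is \<open>0\<close> or of modulus at least \<open>1\<close>. Applied to determinants of pairs
  of orbit vectors this makes the slopes of \<open>g \<Lambda>\<close> in the strip \<open>S\<^sub>1\<close> differ by at least \<open>1\<close>; the
  horocycle flow translates these slopes, so a coset whose orbit meets the strip lies above exactly
  one point of the suspension.

  Haar measure on \<open>SL\<^sub>2\<close> is Lebesgue measure in the coordinates \<open>(a, b, s)\<close> of \<open>h\<^sub>s g\<^sub>a\<^sub>b\<close>, so the
  suspension is a fundamental domain for the cosets meeting the strip, and its volume is the
  integral of the roof function. Those cosets have full measure because their dilates exhaust the
  space while all having the same finite measure. Uniqueness of the invariant probability measure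
  is a Fubini argument with a Borel section of the quotient.
\<close>

section \<open>Two by two matrices and the Hecke group\<close>

text \<open>The obstacle behind the gap is cancellation: entries of a general group element are sums
  with terms of both signs. The rows of a word have constant sign, so multiplying by a nonnegative
  matrix on the right only adds moduli, and the entries of \<open>U^k T\<close> are quotients sin (j
  pi / q) / sin (pi / q) with j \<le> q, each 0 or at least 1. The constant 1 fits the strip, whose
  vectors have first coordinate at most 1. Finite volume is not taken for granted. It results from a
  bound of the roof by a multiple of 1 / a plus a multiple of 1 / b, the latter only where the point
  (b, a) lies in the triangle as well; the fibre of the triangle over a has length proportional to
  a. Since \<open>mu_q\<close> is a definite description over measures invariant under all of
  \<open>SL2\<close>, nothing can be said about it before existence and uniqueness are shown. The
  suspension displays invariance under the flow only, and it covers only the cosets that meet the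
  strip. Hence the strict fundamental domain \<open>fulldom\<close> of the whole space, built from
  dilates of the suspension.\<close>

lemma mat2_nth [simp]:
  "mat2 a b c d $ 1 $ 1 = a" "mat2 a b c d $ 1 $ 2 = b"
  "mat2 a b c d $ 2 $ 1 = c" "mat2 a b c d $ 2 $ 2 = d"
  by (simp_all add: mat2_def)

lemma mat2_eq_iff:
  fixes A B :: mat2
  shows "A = B \<longleftrightarrow> A$1$1 = B$1$1 \<and> A$1$2 = B$1$2 \<and> A$2$1 = B$2$1 \<and> A$2$2 = B$2$2"
  by (auto simp: vec_eq_iff forall_2)

lemma mult_nth:
  fixes A B :: mat2
  shows "(A ** B) $ i $ j = A$i$1 * B$1$j + A$i$2 * B$2$j"
  by (simp add: matrix_matrix_mult_def sum_2)

lemma mulv_nth: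
  fixes A :: mat2
  shows "(A *v v) $ i = A$i$1 * v$1 + A$i$2 * v$2"
  by (simp add: matrix_vector_mult_def sum_2)

lemma one_nth [simp]:
  "(mat 1 :: mat2) $ 1 $ 1 = 1" "(mat 1 :: mat2) $ 1 $ 2 = 0"
  "(mat 1 :: mat2) $ 2 $ 1 = 0" "(mat 1 :: mat2) $ 2 $ 2 = 1"
  by (simp_all add: mat_def)

lemma vec2_eq_iff:
  fixes v w :: vec2
  shows "v = w \<longleftrightarrow> v$1 = w$1 \<and> v$2 = w$2"
  by (auto simp: vec_eq_iff forall_2)

lemmas mat2_simps = mat2_eq_iff mult_nth mulv_nth vec2_eq_iff

lemma SL2_iff: "A \<in> SL2 \<longleftrightarrow> A$1$1 * A$2$2 - A$1$2 * A$2$1 = 1"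
  by (simp add: SL2_def det_2)

lemma SL2_mult: "A \<in> SL2 \<Longrightarrow> B \<in> SL2 \<Longrightarrow> A ** B \<in> SL2"
  by (simp add: SL2_def det_mul)

text \<open>The adjugate. It is polynomial in the entries, hence Borel on all matrices, and it
  reverses products without a determinant condition. On \<open>SL2\<close> it is the inverse, for
  which \<open>matrix_inv\<close> is only a choice term.\<close>

definition minv :: "mat2 \<Rightarrow> mat2" where
  "minv A = mat2 (A$2$2) (- A$1$2) (- A$2$1) (A$1$1)"

lemma minv_nth [simp]:
  "minv A $ 1 $ 1 = A$2$2" "minv A $ 1 $ 2 = - A$1$2"
  "minv A $ 2 $ 1 = - A$2$1" "minv A $ 2 $ 2 = A$1$1"
  by (simp_all add: minv_def)

lemma minv_SL2: "A \<in> SL2 \<Longrightarrow> minv A \<in> SL2"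
  by (simp add: SL2_iff algebra_simps)

lemma minv_right: "A \<in> SL2 \<Longrightarrow> A ** minv A = mat 1"
  and minv_left: "A \<in> SL2 \<Longrightarrow> minv A ** A = mat 1"
  by (auto simp: SL2_iff mat2_simps algebra_simps)

lemma minv_minv [simp]: "minv (minv A) = A"
  by (simp add: mat2_simps)

lemma minv_mult: "minv (A ** B) = minv B ** minv A"
  by (simp add: mat2_simps algebra_simps)

lemma minv_cancel:
  assumes "A \<in> SL2"
  shows "A ** (minv A ** B) = B" "minv A ** (A ** B) = B"
    "B ** A ** minv A = B" "B ** minv A ** A = B"
proof -
  show "A ** (minv A ** B) = B" "minv A ** (A ** B) = B"
    unfolding matrix_mul_assoc minv_right[OF assms] minv_left[OF assms] by simp_all
  show "B ** A ** minv A = B" "B ** minv A ** A = B"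
    unfolding matrix_mul_assoc[symmetric] minv_right[OF assms] minv_left[OF assms] by simp_all
qed

lemma matrix_inv_SL2:
  assumes "A \<in> SL2" shows "matrix_inv A = minv A"
proof -
  have "\<exists>A'. A ** A' = mat 1 \<and> A' ** A = mat 1"
    using minv_right[OF assms] minv_left[OF assms] by blast
  from someI_ex[OF this] have "matrix_inv A ** A = mat 1"
    by (simp add: matrix_inv_def)
  then have "matrix_inv A ** A ** minv A = minv A"
    by simp
  then show ?thesis
    by (simp add: minv_cancel assms)
qed

lemma SL2_one: "mat 1 \<in> SL2" and SL2_Smat: "Smat \<in> SL2" and SL2_Tmat: "Tmat q \<in> SL2"
  and SL2_hmat: "hmat t \<in> SL2"
  by (simp_all add: SL2_iff Smat_def Tmat_def hmat_def)

lemma SL2_gmat: "a \<noteq> 0 \<Longrightarrow> gmat a b \<in> SL2"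
  by (simp add: SL2_iff gmat_def)

lemma hmat_add: "hmat s ** hmat t = hmat (s + t)"
  by (simp add: hmat_def mat2_simps)

lemma hmat_0: "hmat 0 = mat 1"
  by (simp add: hmat_def mat2_simps)

lemma Gq_SL2: "A \<in> Gq q \<Longrightarrow> A \<in> SL2"
  by (induction rule: Gq.induct)
    (auto simp: SL2_one SL2_mult SL2_Smat SL2_Tmat matrix_inv_SL2 minv_SL2)

lemma Gq_mult: "B \<in> Gq q \<Longrightarrow> A \<in> Gq q \<Longrightarrow> A ** B \<in> Gq q"
  by (induction rule: Gq.induct) (auto simp: matrix_mul_assoc intro: Gq.intros)

lemma Smat_Gq: "Smat \<in> Gq q" and Tmat_Gq: "Tmat q \<in> Gq q"
  and Smat_inv_Gq: "minv Smat \<in> Gq q" and Tmat_inv_Gq: "minv (Tmat q) \<in> Gq q"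
  using Gq_S[OF Gq_one] Gq_T[OF Gq_one] Gq_Sinv[OF Gq_one] Gq_Tinv[OF Gq_one]
  by (simp_all add: matrix_inv_SL2 SL2_Smat SL2_Tmat)

lemma Gq_minv: "A \<in> Gq q \<Longrightarrow> minv A \<in> Gq q"
proof (induction rule: Gq.induct)
  case Gq_one
  have "minv (mat 1) = mat 1" by (simp add: mat2_simps)
  then show ?case by (simp add: Gq.Gq_one)
qed (auto simp: minv_mult matrix_inv_SL2 SL2_Smat SL2_Tmat
    intro: Gq_mult Smat_Gq Tmat_Gq Smat_inv_Gq Tmat_inv_Gq)

lemma Gq_uminus: "A \<in> Gq q \<Longrightarrow> - A \<in> Gq q"
proof -
  assume "A \<in> Gq q"
  then have "A ** Smat ** Smat \<in> Gq q" by (intro Gq.intros)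
  also have "A ** Smat ** Smat = - A" by (simp add: mat2_simps Smat_def)
  finally show ?thesis .
qed

text \<open>Countability turns conditions over the group into countable unions of Borel sets, and
  lets sums over the group be exchanged with \<open>haar\<close>.\<close>

lemma countable_Gq: "countable (Gq q)"
proof -
  define X where "X = {Smat, matrix_inv Smat, Tmat q, matrix_inv (Tmat q)}"
  define W where "W = (\<lambda>xs. fold (\<lambda>x y. y ** x) xs (mat 1)) ` lists X"
  have W_step: "A ** B \<in> W" if "A \<in> W" "B \<in> X" for A B
  proof -
    from that(1) obtain xs where "xs \<in> lists X" "A = fold (\<lambda>x y. y ** x) xs (mat 1)"
      unfolding W_def by (elim imageE)
    then show ?thesis unfolding W_def
      by (intro image_eqI[of _ _ "xs @ [B]"]) (simp_all add: that(2))
  qed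
  have "A \<in> W" if "A \<in> Gq q" for A
    using that
  proof (induction rule: Gq.induct)
    case Gq_one
    show ?case unfolding W_def by (rule image_eqI[of _ _ "[]"]) simp_all
  qed (simp_all add: W_step X_def)
  then have "Gq q \<subseteq> W" by (rule subsetI)
  moreover have "countable W"
    unfolding W_def by (intro countable_image countable_lists) (simp add: X_def)
  ultimately show ?thesis by (rule countable_subset)
qed

definition Tpow :: "nat \<Rightarrow> int \<Rightarrow> mat2" where
  "Tpow q n = mat2 1 (of_int n * lambda_q q) 0 1"

lemma Tpow_Gq: "Tpow q n \<in> Gq q"
proof (induction n rule: int_induct[where k = 0])
  case base
  have "Tpow q 0 = mat 1" by (simp add: Tpow_def mat2_simps)
  then show ?case by (simp add: Gq.Gq_one)
next
  case (step1 i)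
  have "Tpow q (i + 1) = Tpow q i ** Tmat q" by (simp add: Tpow_def Tmat_def mat2_simps algebra_simps)
  then show ?case using step1 by (simp add: Gq_T)
next
  case (step2 i)
  have "Tpow q (i - 1) = Tpow q i ** minv (Tmat q)" by (simp add: Tpow_def Tmat_def mat2_simps algebra_simps)
  then show ?case using step2 by (simp add: Gq_mult Tmat_inv_Gq)
qed

text \<open>Conjugation by diag(1, -1). It exchanges the generators with their inverses, hence
  preserves the group, and it changes the sign of the slope of the first column.\<close>

definition reflect :: "mat2 \<Rightarrow> mat2" where
  "reflect A = mat2 (A$1$1) (- A$1$2) (- A$2$1) (A$2$2)"

lemma reflect_mult: "reflect (A ** B) = reflect A ** reflect B"
  by (simp add: reflect_def mat2_simps)

lemma reflect_generators:
  "reflect (mat 1) = mat 1" "reflect Smat = minv Smat" "reflect (minv Smat) = Smat"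
  "reflect (Tmat q) = minv (Tmat q)" "reflect (minv (Tmat q)) = Tmat q"
  by (simp_all add: reflect_def mat2_simps Smat_def Tmat_def)

lemma reflect_Gq: "A \<in> Gq q \<Longrightarrow> reflect A \<in> Gq q"
  by (induction rule: Gq.induct)
    (auto simp: reflect_mult reflect_generators matrix_inv_SL2 SL2_Smat SL2_Tmat
      intro: Gq.Gq_one Gq_mult Smat_Gq Tmat_Gq Smat_inv_Gq Tmat_inv_Gq)

section \<open>Gaps between the matrix entries of the group\<close>

text \<open>For j \<ge> 1 the value at cos (pi / q) of the Chebyshev polynomial of the second kind
  of degree j - 1.\<close>

definition usin :: "nat \<Rightarrow> nat \<Rightarrow> real" where
  "usin q j = sin (real j * pi / real q) / sin (pi / real q)"

text \<open>Closed form of \<open>(T S)^k T\<close>, as \<open>Amat_0\<close> and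
  \<open>Amat_Suc\<close> show. For k \<le> q - 2 all indices stay within 0..q, where the sines are
  nonnegative.\<close>

definition Amat :: "nat \<Rightarrow> nat \<Rightarrow> mat2" where
  "Amat q k = mat2 (usin q (k + 1)) (usin q (k + 2)) (usin q k) (usin q (k + 1))"

definition gap :: "real \<Rightarrow> bool" where
  "gap x \<longleftrightarrow> x = 0 \<or> 1 \<le> \<bar>x\<bar>"

context
  fixes q :: nat
  assumes q3: "q \<ge> 3"
begin

lemma sin_pi_q_pos: "0 < sin (pi / real q)"
  using q3 by (intro sin_gt_zero) (auto simp: field_simps)

lemma usin_0 [simp]: "usin q 0 = 0" and usin_1 [simp]: "usin q (Suc 0) = 1"
  and usin_q: "usin q q = 0"
  using sin_pi_q_pos q3 by (auto simp: usin_def)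

lemma usin_rec: "usin q (k + 2) = lambda_q q * usin q (k + 1) - usin q k"
proof -
  let ?x = "pi / real q"
  have "sin ((real k + 1) * ?x + ?x) + sin ((real k + 1) * ?x - ?x) = 2 * cos ?x * sin ((real k + 1) * ?x)"
    by (simp add: sin_add sin_diff)
  then have "sin (real (k + 2) * pi / real q) = 2 * cos ?x * sin (real (k + 1) * pi / real q) - sin (real k * pi / real q)"
    by (simp add: algebra_simps add_divide_distrib)
  then show ?thesis
    by (simp add: usin_def lambda_q_def diff_divide_distrib)
qed

lemma usin_2: "usin q 2 = lambda_q q"
  using usin_rec[of 0] by (simp add: numeral_2_eq_2)

lemma usin_reflect: "k \<le> q \<Longrightarrow> usin q (q - k) = usin q k"
proof -
  assume "k \<le> q"
  then have "real (q - k) * pi / real q = pi - real k * pi / real q"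
    using q3 by (simp add: of_nat_diff field_simps)
  then show ?thesis by (simp add: usin_def)
qed

lemma usin_mono: "j \<le> k \<Longrightarrow> 2 * k \<le> q \<Longrightarrow> usin q j \<le> usin q k"
proof -
  assume jk: "j \<le> k" "2 * k \<le> q"
  then have "2 * real k \<le> real q" by linarith
  then have "real k * pi / real q \<le> pi / 2"
    using q3 mult_right_mono[of "2 * real k" "real q" pi] by (simp add: field_simps)
  moreover have "real j * pi / real q \<le> real k * pi / real q"
    using jk by (intro divide_right_mono mult_right_mono) auto
  moreover have "- (pi / 2) \<le> real j * pi / real q"
    by (rule order.trans[of _ 0]) auto
  ultimately have "sin (real j * pi / real q) \<le> sin (real k * pi / real q)"
    by (intro sin_monotone_2pi_le) auto
  then show ?thesis
    using sin_pi_q_pos by (simp add: usin_def divide_right_mono)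
qed

lemma lambda_ge_1: "1 \<le> lambda_q q" and lambda_less_2: "lambda_q q < 2"
proof -
  have "cos (pi / 3) \<le> cos (pi / real q)"
    using q3 by (intro cos_monotone_0_pi_le) (auto simp: field_simps)
  then show "1 \<le> lambda_q q" by (simp add: lambda_q_def cos_60)
  have "cos (pi / real q) < cos 0"
    using q3 by (intro cos_monotone_0_pi) (auto simp: field_simps)
  then show "lambda_q q < 2" by (simp add: lambda_q_def)
qed

lemma usin_ge_1: "1 \<le> k \<Longrightarrow> k < q \<Longrightarrow> 1 \<le> usin q k"
proof (cases "2 * k \<le> q")
  case True
  assume "1 \<le> k" then show ?thesis using usin_mono[OF _ True, of "Suc 0"] by simp
next
  case False
  assume "1 \<le> k" "k < q"
  then show ?thesis
    using usin_mono[of "Suc 0" "q - k"] False usin_reflect[of k] by simp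
qed

text \<open>Strictness keeps the denominators \<open>usin q k - 1\<close> in the estimate of the
  roof function positive. The range is empty for q = 3, and for q \<ge> 4 already
  \<open>lambda_q q\<close> exceeds 1.\<close>

lemma usin_gt_1: "2 \<le> k \<Longrightarrow> k \<le> q - 2 \<Longrightarrow> 1 < usin q k"
proof -
  assume k: "2 \<le> k" "k \<le> q - 2"
  then have "q \<ge> 4" by simp
  then have "cos (pi / 3) < cos (pi / real q)"
    using q3 by (intro cos_monotone_0_pi) (auto simp: field_simps)
  then have l: "1 < lambda_q q" by (simp add: lambda_q_def cos_60)
  show ?thesis
  proof (cases "2 * k \<le> q")
    case True
    show ?thesis using usin_mono[OF k(1) True] l by (simp add: usin_2)
  next
    case False
    have "2 \<le> q - k" "2 * (q - k) \<le> q" "k \<le> q" using k False by linarith+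
    then show ?thesis
      using usin_mono[of 2 "q - k"] l usin_reflect[of k] by (simp add: usin_2)
  qed
qed

lemma usin_gap: "k \<le> q \<Longrightarrow> usin q k = 0 \<or> 1 \<le> usin q k"
  by (cases "k = 0 \<or> k = q") (use usin_q usin_ge_1 in auto)

lemma usin_q_minus_1: "usin q (q - 1) = 1"
  using usin_reflect[of 1] q3 by simp

lemma usin_q_minus_2: "usin q (q - 2) = lambda_q q"
  using usin_reflect[of 2] q3 by (simp add: usin_2)

text \<open>This is the determinant of \<open>Amat q k\<close>. It later expresses a through the
  first coordinates of two consecutive vectors.\<close>

lemma usin_det: "usin q (k + 1) * usin q (k + 1) - usin q k * usin q (k + 2) = 1"
proof (induction k)
  case 0 show ?case by simp
next
  case (Suc k)
  have "usin q (Suc k + 1) * usin q (Suc k + 1) - usin q (Suc k) * usin q (Suc k + 2)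
     = usin q (k + 2) * usin q (k + 2) - usin q (k + 1) * (lambda_q q * usin q (k + 2) - usin q (k + 1))"
    using usin_rec[of "Suc k"] by simp
  also have "\<dots> = usin q (k+2) * (usin q (k+2) - lambda_q q * usin q (k + 1)) + usin q (k + 1) * usin q (k + 1)"
    by (simp add: algebra_simps)
  also have "\<dots> = usin q (k + 1) * usin q (k + 1) - usin q k * usin q (k + 2)"
    unfolding usin_rec[of k] by (simp add: algebra_simps)
  finally show ?case using Suc by simp
qed

section \<open>Normal form of the group elements\<close>

lemma Amat_0: "Amat q 0 = Tmat q"
  using usin_2 by (simp add: Amat_def Tmat_def mat2_simps numeral_2_eq_2)

lemma Amat_Suc: "Amat q k ** (Smat ** Tmat q) = Amat q (Suc k)"
  using usin_rec[of k] usin_rec[of "Suc k"]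
  by (simp add: Amat_def Tmat_def Smat_def mat2_simps algebra_simps)

lemma Amat_Gq: "Amat q k \<in> Gq q"
proof (induction k)
  case 0 show ?case by (simp add: Amat_0 Tmat_Gq)
next
  case (Suc k)
  then show ?case unfolding Amat_Suc[symmetric] by (intro Gq_mult Smat_Gq Tmat_Gq)
qed

lemma Amat_last: "Amat q (q - 2) = mat2 (1::real) 0 (lambda_q q) 1"
proof -
  have "q - 2 + 1 = q - 1" "q - 2 + 2 = q" using q3 by auto
  then show ?thesis unfolding Amat_def by (simp only: usin_q usin_q_minus_1 usin_q_minus_2)
qed

text \<open>All factors after the initial one are nonnegative, and no S is appended to them. A group
  element is therefore a word only up to a final S, which merely permutes columns up to
  sign.\<close>

inductive_set words :: "mat2 set" where
  base: "m \<in> {mat 1, - mat 1, Smat, - Smat} \<Longrightarrow> m \<in> words"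
| step: "m \<in> words \<Longrightarrow> k \<le> q - 2 \<Longrightarrow> m ** Amat q k \<in> words"

lemma mult_uminus_mat2: "(- A) ** B = - (A ** B)" "A ** (- B) = - (A ** B)" for A B :: mat2
  by (simp_all add: mat2_simps)

lemma words_uminus: "m \<in> words \<Longrightarrow> - m \<in> words"
proof (induction rule: words.induct)
  case (base m) then show ?case by (intro words.base) auto
next
  case (step m k) then show ?case using words.step[of "- m" k] by (simp add: mult_uminus_mat2)
qed

lemma S_S: "Smat ** Smat = - mat 1" "A ** Smat ** Smat = - A"
  for A :: mat2
  by (simp_all add: Smat_def mat2_eq_iff mult_nth)

lemma minv_S: "minv Smat = - Smat" by (simp add: Smat_def mat2_simps)

text \<open>Appending S T raises the index of the last factor by one. At the top index q - 2 the
  relation (T S)^q = -1 removes that factor, at the price of a final S.\<close>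

lemma words_ST:
  assumes "m \<in> words"
  shows "m ** (Smat ** Tmat q) \<in> words \<or> m ** (Smat ** Tmat q) ** Smat \<in> words"
  using assms
proof cases
  case base
  then have "m ** Smat \<in> {mat 1, - mat 1, Smat, - Smat}"
    by (auto simp: S_S mult_uminus_mat2)
  from words.step[OF words.base[OF this], of 0] show ?thesis
    by (simp add: Amat_0 matrix_mul_assoc)
next
  case (step m' k)
  have *: "m ** (Smat ** Tmat q) = m' ** Amat q (Suc k)"
    unfolding step(1) Amat_Suc[symmetric] by (simp add: matrix_mul_assoc)
  show ?thesis
  proof (cases "Suc k \<le> q - 2")
    case True
    then show ?thesis using words.step[OF step(2) True] * by simp
  next
    case False
    then have "k = q - 2" using step by simp
    then have "m ** (Smat ** Tmat q) ** Smat = m' ** (Amat q (q - 2) ** (Smat ** Tmat q) ** Smat)"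
      unfolding step(1) by (simp add: matrix_mul_assoc)
    also have "Amat q (q - 2) ** (Smat ** Tmat q) ** Smat = - mat 1"
      by (simp add: Amat_last Smat_def Tmat_def mat2_simps)
    finally show ?thesis using words_uminus[OF step(2)] by (simp add: mult_uminus_mat2)
  qed
qed

text \<open>The inverse of T has a negative entry; this relation trades it for the nonnegative
  \<open>Amat q (q - 2)\<close>.\<close>

lemma Tinv_eq: "minv (Tmat q) ** Smat = Smat ** Amat q (q - 2)"
  by (simp add: Amat_last Smat_def Tmat_def mat2_simps)

text \<open>The inverse of T cancels a last factor T; otherwise, followed by S, it lowers the index
  of the last factor by one, up to sign.\<close>

lemma words_Tinv:
  assumes "m \<in> words"
  shows "m ** minv (Tmat q) \<in> words \<or> m ** minv (Tmat q) ** Smat \<in> words"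
  using assms
proof cases
  case base
  then have "m ** Smat \<in> {mat 1, - mat 1, Smat, - Smat}"
    by (auto simp: S_S mult_uminus_mat2)
  from words.step[OF words.base[OF this] order.refl] have "m ** (minv (Tmat q) ** Smat) \<in> words"
    unfolding Tinv_eq by (simp add: matrix_mul_assoc)
  then show ?thesis by (simp add: matrix_mul_assoc)
next
  case (step m' k)
  show ?thesis
  proof (cases k)
    case 0
    then have "m ** minv (Tmat q) = m'"
      unfolding step(1) by (simp add: Amat_0 minv_cancel SL2_Tmat)
    then show ?thesis using step by simp
  next
    case (Suc j)
    have "m ** minv (Tmat q) ** Smat = m' ** (Amat q j ** Smat ** Tmat q ** minv (Tmat q) ** Smat)"
      unfolding step(1) Suc Amat_Suc[symmetric] by (simp add: matrix_mul_assoc)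
    also have "\<dots> = - (m' ** Amat q j)"
      by (simp add: minv_cancel SL2_Tmat S_S mult_uminus_mat2)
    finally show ?thesis using words_uminus[OF words.step[OF step(2), of j]] step(3) Suc by simp
  qed
qed

lemma Gq_words: "A \<in> Gq q \<Longrightarrow> A \<in> words \<or> A ** Smat \<in> words"
proof (induction rule: Gq.induct)
  case Gq_one then show ?case by (auto intro: words.base)
next
  case (Gq_S A) then show ?case by (auto simp: S_S words_uminus)
next
  case (Gq_Sinv A)
  then show ?case using words_uminus[of "A ** Smat"]
    by (auto simp: matrix_inv_SL2 SL2_Smat minv_S mult_uminus_mat2 S_S)
next
  case (Gq_T A)
  from Gq_T.IH show ?case
  proof
    assume "A \<in> words"
    from words.step[OF this, of 0] show ?thesis by (simp add: Amat_0)
  next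
    assume "A ** Smat \<in> words"
    from words_uminus[OF this] have *: "- (A ** Smat) \<in> words" .
    have "- (A ** Smat) ** (Smat ** Tmat q) = A ** Tmat q"
      by (simp add: matrix_mul_assoc S_S mult_uminus_mat2)
    then show ?thesis using words_ST[OF *] by simp
  qed
next
  case (Gq_Tinv A)
  from Gq_Tinv.IH show ?case
  proof
    assume "A \<in> words"
    from words_Tinv[OF this] show ?thesis by (simp add: matrix_inv_SL2 SL2_Tmat)
  next
    assume *: "A ** Smat \<in> words"
    have "A ** (minv (Tmat q) ** Smat) \<in> words"
      unfolding Tinv_eq using words.step[OF * order.refl] by (simp add: matrix_mul_assoc)
    then show ?thesis by (simp add: matrix_inv_SL2 SL2_Tmat matrix_mul_assoc)
  qed
qed

text \<open>Since x and y do not have opposite signs and u, v are nonnegative, nothing cancels: the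
  modulus of the sum is the sum of the moduli, each of which is 0 or at least 1.\<close>

lemma gap_lin:
  assumes "gap x" "gap y" "0 \<le> x * y" "u = 0 \<or> 1 \<le> u" "v = 0 \<or> 1 \<le> v"
  shows "gap (x * u + y * v)"
proof -
  have a: "\<bar>x * u + y * v\<bar> = \<bar>x\<bar> * u + \<bar>y\<bar> * v"
  proof (cases "x \<ge> 0 \<and> y \<ge> 0")
    case True then show ?thesis using assms(4,5) by (auto intro!: abs_of_nonneg add_nonneg_nonneg)
  next
    case False
    then have "x \<le> 0" "y \<le> 0" using assms(3) by (auto simp: zero_le_mult_iff)
    then have "x * u \<le> 0" "y * v \<le> 0" using assms(4,5) by (auto intro!: mult_nonpos_nonneg)
    then have "\<bar>x * u + y * v\<bar> = - (x * u + y * v)" by (intro abs_of_nonpos) simp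
    then show ?thesis using \<open>x \<le> 0\<close> \<open>y \<le> 0\<close> by (simp add: abs_of_nonpos)
  qed
  have b: "t = 0 \<or> 1 \<le> t" if "gap z" "w = 0 \<or> 1 \<le> w" "t = \<bar>z\<bar> * w" for z w t :: real
    using that mult_mono[of 1 "\<bar>z\<bar>" 1 w] by (auto simp: gap_def)
  have "gap \<bar>x * u + y * v\<bar>"
    unfolding a using b[OF assms(1,4) refl] b[OF assms(2,5) refl] by (auto simp: gap_def)
  then show ?thesis by (simp add: gap_def)
qed

text \<open>The gap by itself is not inductive. The second conjunct, one sign per row, is what
  prevents cancellation at the next factor.\<close>

lemma words_gap:
  "m \<in> words \<Longrightarrow> (\<forall>i j. gap (m $ i $ j)) \<and> (\<forall>i. 0 \<le> m $ i $ 1 * m $ i $ 2)"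
proof (induction rule: words.induct)
  case (base m)
  then show ?case by (auto simp: gap_def forall_2 Smat_def)
next
  case (step m k)
  have k: "k \<le> q" "k + 1 \<le> q" "k + 2 \<le> q" using step q3 by auto
  note u = usin_gap[OF k(1)] usin_gap[OF k(2)] usin_gap[OF k(3)]
  have e: "(m ** Amat q k) $ i $ 1 = m$i$1 * usin q (k+1) + m$i$2 * usin q k"
       "(m ** Amat q k) $ i $ 2 = m$i$1 * usin q (k+2) + m$i$2 * usin q (k+1)" for i
    by (simp_all add: mult_nth Amat_def)
  have p: "0 \<le> (x * u + y * v) * (x * s + y * t)"
    if "0 \<le> x * y" "0 \<le> u" "0 \<le> v" "0 \<le> s" "0 \<le> t" for x y u v s t :: real
  proof -
    have "(x * u + y * v) * (x * s + y * t) = x * x * (u * s) + y * y * (v * t) + x * y * (u * t + v * s)"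
      by (simp add: algebra_simps)
    then show ?thesis using that by simp
  qed
  have nn: "0 \<le> usin q k" "0 \<le> usin q (k+1)" "0 \<le> usin q (k+2)" using u by auto
  show ?case
    unfolding forall_2 e using step.IH u nn
    by (auto intro!: gap_lin p simp: forall_2)
qed

lemma Gq_gap: assumes "A \<in> Gq q" shows "gap (A $ i $ j)"
proof -
  have "\<forall>i j. gap (A $ i $ j)"
    using Gq_words[OF assms]
  proof
    assume "A \<in> words" then show ?thesis using words_gap by blast
  next
    assume "A ** Smat \<in> words"
    then have "\<forall>i j. gap ((A ** Smat) $ i $ j)" using words_gap by blast
    then show ?thesis by (auto simp: forall_2 mult_nth Smat_def gap_def)
  qed
  then show ?thesis by blast
qed

end

section \<open>Slopes and the cross section\<close>

abbreviation gp :: "real \<times> real \<Rightarrow> mat2" where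
  "gp p \<equiv> gmat (fst p) (snd p)"

text \<open>Slopes of either sign are kept, since this is the set that the horocycle flow
  translates. At a point of the section the roof is its least positive element.\<close>

definition slopes :: "nat \<Rightarrow> mat2 \<Rightarrow> real set" where
  "slopes q g = {slope v | v. v \<in> glat q g \<inter> S1}"

lemma coset_self: "g \<in> coset q g"
  unfolding coset_def by (rule image_eqI[of _ _ "mat 1"]) (simp_all add: Gq.Gq_one)

lemma coset_mult_Gq:
  assumes "\<gamma> \<in> Gq q" shows "coset q (g ** \<gamma>) = coset q g"
proof
  show "coset q (g ** \<gamma>) \<subseteq> coset q g"
  proof
    fix h assume "h \<in> coset q (g ** \<gamma>)"
    then obtain \<delta> where \<delta>: "\<delta> \<in> Gq q" "h = g ** (\<gamma> ** \<delta>)"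
      unfolding coset_def by (auto simp: matrix_mul_assoc)
    then show "h \<in> coset q g"
      unfolding coset_def using Gq_mult[OF \<delta>(1) assms] by blast
  qed
  show "coset q g \<subseteq> coset q (g ** \<gamma>)"
  proof
    fix h assume "h \<in> coset q g"
    then obtain \<delta> where \<delta>: "\<delta> \<in> Gq q" "h = g ** \<delta>" by (auto simp: coset_def)
    have "h = g ** \<gamma> ** (minv \<gamma> ** \<delta>)"
      unfolding matrix_mul_assoc minv_cancel(3)[OF Gq_SL2[OF assms]] by (rule \<delta>(2))
    then show "h \<in> coset q (g ** \<gamma>)"
      unfolding coset_def using Gq_mult[OF \<delta>(1) Gq_minv[OF assms]] by blast
  qed
qed

lemma coset_eqI: assumes "h \<in> coset q g" shows "coset q h = coset q g"
proof -
  obtain \<gamma> where "\<gamma> \<in> Gq q" "h = g ** \<gamma>" using assms unfolding coset_def by blast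
  then show ?thesis using coset_mult_Gq by simp
qed

lemma lmul_coset: "lmul h (coset q g) = coset q (h ** g)"
  by (auto simp: lmul_def coset_def matrix_mul_assoc image_image)

lemma coset_SL2: "g \<in> SL2 \<Longrightarrow> h \<in> coset q g \<Longrightarrow> h \<in> SL2"
  by (auto simp: coset_def intro: SL2_mult Gq_SL2)

text \<open>The vector \<gamma> (1, 0) is the first column of \<gamma>, so the lattice consists of
  the first columns of the coset. Equal cosets thus have equal lattices and equal slopes.\<close>

lemma glat_iff: "w \<in> glat q g \<longleftrightarrow> (\<exists>h\<in>coset q g. w$1 = h$1$1 \<and> w$2 = h$2$1)"
proof -
  have "(w = g *v (\<gamma> *v vector [1, 0])) \<longleftrightarrow> (w$1 = (g ** \<gamma>)$1$1 \<and> w$2 = (g ** \<gamma>)$2$1)" for \<gamma> :: mat2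
    unfolding matrix_vector_mul_assoc by (simp add: vec2_eq_iff mulv_nth[of "g ** \<gamma>"])
  then show ?thesis
    unfolding glat_def Lambda_q_def coset_def by blast
qed

lemma slopes_iff:
  "r \<in> slopes q g \<longleftrightarrow> (\<exists>h\<in>coset q g. 0 < h$1$1 \<and> h$1$1 \<le> 1 \<and> r = h$2$1 / h$1$1)"
proof
  assume "r \<in> slopes q g"
  then show "\<exists>h\<in>coset q g. 0 < h$1$1 \<and> h$1$1 \<le> 1 \<and> r = h$2$1 / h$1$1"
    unfolding slopes_def S1_def slope_def by (auto simp: glat_iff)
next
  assume "\<exists>h\<in>coset q g. 0 < h$1$1 \<and> h$1$1 \<le> 1 \<and> r = h$2$1 / h$1$1"
  then obtain h where h: "h \<in> coset q g" "0 < h$1$1" "h$1$1 \<le> 1" "r = h$2$1 / h$1$1" by blast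
  let ?v = "vector [h$1$1, h$2$1] :: vec2"
  have "?v \<in> glat q g \<inter> S1" using h by (auto simp: glat_iff S1_def)
  moreover have "r = slope ?v" using h by (simp add: slope_def)
  ultimately show "r \<in> slopes q g" unfolding slopes_def by blast
qed

lemma slopesI: "\<gamma> \<in> Gq q \<Longrightarrow> 0 < (g ** \<gamma>)$1$1 \<Longrightarrow> (g ** \<gamma>)$1$1 \<le> 1 \<Longrightarrow>
    (g ** \<gamma>)$2$1 / (g ** \<gamma>)$1$1 \<in> slopes q g"
  unfolding slopes_iff coset_def by blast

lemma slopes_cong: "coset q g = coset q g' \<Longrightarrow> slopes q g = slopes q g'"
  by (auto simp: slopes_iff)

lemma slopes_hmat: "r \<in> slopes q (hmat t ** g) \<longleftrightarrow> r + t \<in> slopes q g"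
proof -
  have "(0 < (hmat t ** g ** \<gamma>)$1$1 \<and> (hmat t ** g ** \<gamma>)$1$1 \<le> 1 \<and>
         r = (hmat t ** g ** \<gamma>)$2$1 / (hmat t ** g ** \<gamma>)$1$1) \<longleftrightarrow>
        (0 < (g ** \<gamma>)$1$1 \<and> (g ** \<gamma>)$1$1 \<le> 1 \<and> r + t = (g ** \<gamma>)$2$1 / (g ** \<gamma>)$1$1)" for \<gamma> :: mat2
    unfolding matrix_mul_assoc[symmetric] mult_nth[of "hmat t" "g ** \<gamma>"]
    by (auto simp: hmat_def field_simps)
  then show ?thesis unfolding slopes_iff coset_def by simp
qed

lemma Rq_Least: "Rq q p = (LEAST r. r \<in> slopes q (gp p) \<and> 0 < r)"
proof -
  have "(r \<in> {slope v |v. v \<in> glat q (gp p) \<inter> S1 \<and> 0 < slope v}) = (r \<in> slopes q (gp p) \<and> 0 < r)" for r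
    unfolding slopes_def by auto
  then show ?thesis unfolding Rq_def by simp
qed

lemma separated_has_min:
  fixes A :: "real set"
  assumes ne: "A \<noteq> {}" and bdd: "\<And>x. x \<in> A \<Longrightarrow> c \<le> x"
    and sep: "\<And>x y. x \<in> A \<Longrightarrow> y \<in> A \<Longrightarrow> x < y \<Longrightarrow> x + 1 \<le> y"
  shows "\<exists>m\<in>A. \<forall>x\<in>A. m \<le> x"
proof -
  have "Inf A < Inf A + 1" by simp
  then obtain m where m: "m \<in> A" "m < Inf A + 1" using cInf_lessD[OF ne] by blast
  have "m \<le> x" if "x \<in> A" for x
  proof (rule ccontr)
    assume "\<not> m \<le> x"
    then have "x + 1 \<le> m" using sep that m by auto
    moreover have "Inf A \<le> x" using that bdd by (intro cInf_lower) (auto simp: bdd_below_def)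
    ultimately show False using m by simp
  qed
  then show ?thesis using m by blast
qed

context
  fixes q :: nat
  assumes q3: "q \<ge> 3"
begin

text \<open>The determinant of the two vectors is the lower left entry of
  \<open>minv (g ** \<gamma>) ** (g ** \<delta>)\<close>, which is the group element
  \<open>minv \<gamma> ** \<delta>\<close>. With first coordinates x and x' it equals x x' (r' - r);
  the gap makes it at least 1, and x x' \<le> 1.\<close>

lemma slopes_separated:
  assumes g: "g \<in> SL2" and r: "r \<in> slopes q g" "r' \<in> slopes q g" "r < r'"
  shows "r + 1 \<le> r'"
proof -
  obtain \<gamma> where \<gamma>: "\<gamma> \<in> Gq q" "0 < (g ** \<gamma>)$1$1" "(g ** \<gamma>)$1$1 \<le> 1" "r = (g ** \<gamma>)$2$1 / (g ** \<gamma>)$1$1"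
    using r(1) unfolding slopes_iff coset_def by blast
  obtain \<delta> where \<delta>: "\<delta> \<in> Gq q" "0 < (g ** \<delta>)$1$1" "(g ** \<delta>)$1$1 \<le> 1" "r' = (g ** \<delta>)$2$1 / (g ** \<delta>)$1$1"
    using r(2) unfolding slopes_iff coset_def by blast
  have "minv (g ** \<gamma>) ** (g ** \<delta>) = minv \<gamma> ** (minv g ** (g ** \<delta>))"
    by (simp add: minv_mult matrix_mul_assoc)
  also have "\<dots> = minv \<gamma> ** \<delta>" by (simp add: minv_cancel g)
  finally have "minv (g ** \<gamma>) ** (g ** \<delta>) \<in> Gq q"
    using Gq_mult[OF \<delta>(1) Gq_minv[OF \<gamma>(1)]] by simp
  then have "gap ((minv (g ** \<gamma>) ** (g ** \<delta>)) $ 2 $ 1)" by (rule Gq_gap[OF q3])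
  moreover have "(minv (g ** \<gamma>) ** (g ** \<delta>)) $ 2 $ 1 = (g ** \<gamma>)$1$1 * (g ** \<delta>)$1$1 * (r' - r)"
    unfolding mult_nth[of "minv _"] \<gamma>(4) \<delta>(4) using \<gamma>(2) \<delta>(2) by (simp add: field_simps)
  moreover have pos: "0 < (g ** \<gamma>)$1$1 * (g ** \<delta>)$1$1" using \<gamma>(2) \<delta>(2) by simp
  ultimately have "1 \<le> (g ** \<gamma>)$1$1 * (g ** \<delta>)$1$1 * (r' - r)"
    using r(3) by (auto simp: gap_def)
  also have "\<dots> \<le> 1 * (r' - r)"
    using \<gamma>(2,3) \<delta>(2,3) r(3) by (intro mult_right_mono mult_le_one) auto
  finally show ?thesis by simp
qed

lemma triangle_pos: "p \<in> BCZ_triangle q \<Longrightarrow> 0 < fst p" "p \<in> BCZ_triangle q \<Longrightarrow> fst p \<le> 1"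
  by (auto simp: BCZ_triangle_def)

lemma gp_SL2: "p \<in> BCZ_triangle q \<Longrightarrow> gp p \<in> SL2"
  using triangle_pos[of p] by (intro SL2_gmat) simp

text \<open>An upper triangular group element with positive diagonal has diagonal entries with
  product 1, each at least 1 by the gap, so both equal 1. Hence a can be read off from the
  lattice.\<close>

lemma horizontal_vector:
  assumes "0 < a" "\<gamma> \<in> Gq q" "(gmat a b ** \<gamma>)$2$1 = 0" "0 < (gmat a b ** \<gamma>)$1$1"
  shows "(gmat a b ** \<gamma>)$1$1 = a"
proof -
  have z: "\<gamma>$2$1 = 0" using assms by (simp add: mult_nth gmat_def)
  then have d: "\<gamma>$1$1 * \<gamma>$2$2 = 1" using Gq_SL2[OF assms(2)] by (simp add: SL2_iff)
  have p: "0 < \<gamma>$1$1" using assms z by (simp add: mult_nth gmat_def zero_less_mult_iff)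
  have "0 < \<gamma>$2$2" using d p zero_less_mult_pos[of "\<gamma>$1$1" "\<gamma>$2$2"] by simp
  then have "1 \<le> \<gamma>$1$1" "1 \<le> \<gamma>$2$2"
    using Gq_gap[OF q3 assms(2), of 1 1] Gq_gap[OF q3 assms(2), of 2 2] p unfolding gap_def by auto
  then have "\<gamma>$1$1 = 1" using d p mult_left_mono[of 1 "\<gamma>$2$2" "\<gamma>$1$1"] by simp
  then show ?thesis using z by (simp add: mult_nth gmat_def)
qed

lemma triangle_unique:
  assumes p: "p \<in> BCZ_triangle q" and p': "p' \<in> BCZ_triangle q" and eq: "glat q (gp p) = glat q (gp p')"
  shows "p = p'"
proof -
  obtain a b a' b' where ab: "p = (a, b)" "p' = (a', b')" by fastforce
  have a: "0 < a" "0 < a'" using p p' ab by (auto simp: BCZ_triangle_def)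
  have "vector [a, 0] \<in> glat q (gp p)"
    unfolding glat_iff using coset_self[of "gp p" q] by (intro bexI[of _ "gp p"]) (auto simp: ab gmat_def)
  then have "vector [a, 0] \<in> glat q (gp p')" using eq by simp
  then obtain \<gamma> where "\<gamma> \<in> Gq q" "a = (gmat a' b' ** \<gamma>)$1$1" "0 = (gmat a' b' ** \<gamma>)$2$1"
    unfolding glat_iff coset_def ab by auto
  then have aa: "a = a'" using horizontal_vector[of a' \<gamma> b'] a by simp
  \<comment> \<open>S maps (1, 0) to (0, 1), so the second column of \<open>gp p\<close> is an orbit
    vector as well.\<close>
  have "vector [b, 1 / a] \<in> glat q (gp p)"
    unfolding glat_iff coset_def using Smat_Gq[of q]
    by (intro bexI[of _ "gp p ** Smat"]) (auto simp: ab gmat_def Smat_def mult_nth)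
  then have "vector [b, 1 / a] \<in> glat q (gp p')" using eq by simp
  then obtain \<gamma> where \<gamma>: "\<gamma> \<in> Gq q" "b = (gmat a' b' ** \<gamma>)$1$1" "1 / a = (gmat a' b' ** \<gamma>)$2$1"
    unfolding glat_iff coset_def ab by auto
  have "\<gamma>$2$1 = 1" using \<gamma>(3) a aa by (simp add: mult_nth gmat_def)
  then have b: "b - b' = a * \<gamma>$1$1" using \<gamma>(2) aa by (simp add: mult_nth gmat_def)
  have n: "gap (\<gamma>$1$1 + of_int n * lambda_q q)" for n
    using Gq_gap[OF q3 Gq_mult[OF \<gamma>(1) Tpow_Gq[of q n]], of 1 1] \<open>\<gamma>$2$1 = 1\<close>
    by (simp add: mult_nth Tpow_def)
  have "\<bar>b - b'\<bar> < lambda_q q * a" using p p' ab aa by (auto simp: BCZ_triangle_def)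
  then have "a * \<bar>\<gamma>$1$1\<bar> < a * lambda_q q" using a by (simp add: b abs_mult mult.commute)
  then have "\<bar>\<gamma>$1$1\<bar> < lambda_q q" using a by simp
  \<comment> \<open>An entry of modulus at least 1 and less than \<open>lambda_q q\<close> would,
    after adding or subtracting \<open>lambda_q q\<close>, become nonzero of modulus below 1,
    because \<open>lambda_q q\<close> is less than 2.\<close>
  then have "\<gamma>$1$1 = 0"
    using n[of 0] n[of 1] n[of "-1"] lambda_less_2[OF q3] by (auto simp: gap_def)
  then show ?thesis using b aa ab by simp
qed

text \<open>Right multiplication by a power n of T keeps the horizontal vector and moves the upper
  right entry by n times \<open>lambda_q q\<close> a. A suitable n brings it into the half-open
  interval of exactly that length which the triangle prescribes.\<close>

lemma horizontal_section:
  assumes g: "g \<in> SL2" and h: "h \<in> coset q g" "h$2$1 = 0" "0 < h$1$1" "h$1$1 \<le> 1"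
  shows "\<exists>p\<in>BCZ_triangle q. coset q g = coset q (gp p)"
proof -
  define a b where "a = h$1$1" and "b = h$1$2"
  define n where "n = \<lfloor>(1 - b) / (lambda_q q * a)\<rfloor>"
  have l: "0 < lambda_q q * a" using lambda_ge_1[OF q3] h by (auto simp: a_def)
  have n: "of_int n \<le> (1 - b) / (lambda_q q * a)" "(1 - b) / (lambda_q q * a) < of_int n + 1"
    unfolding n_def by (simp_all add: floor_correct)
  define b' where "b' = b + of_int n * lambda_q q * a"
  have "of_int n * (lambda_q q * a) \<le> 1 - b" "1 - b < (of_int n + 1) * (lambda_q q * a)"
    using n l by (simp_all only: pos_le_divide_eq pos_divide_less_eq)
  then have t: "(a, b') \<in> BCZ_triangle q"
    using h unfolding BCZ_triangle_def b'_def by (auto simp: a_def algebra_simps)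
  have "h$1$1 * h$2$2 = 1" using coset_SL2[OF g h(1)] h(2) by (simp add: SL2_iff)
  then have "h$2$2 = 1 / a" using h(3) by (simp add: a_def field_simps)
  then have "h ** Tpow q n = gp (a, b')"
    using h(2) by (simp add: mat2_eq_iff mult_nth Tpow_def gmat_def a_def b_def b'_def)
  then have "coset q g = coset q (gp (a, b'))"
    using coset_mult_Gq[OF Tpow_Gq[of q n], of h] coset_eqI[OF h(1)] by simp
  then show ?thesis using t by blast
qed

lemma slope_section:
  assumes g: "g \<in> SL2" and r: "r \<in> slopes q g"
  shows "\<exists>p\<in>BCZ_triangle q. coset q (hmat r ** g) = coset q (gp p)"
proof -
  have "0 \<in> slopes q (hmat r ** g)" using r by (simp add: slopes_hmat)
  then obtain h where "h \<in> coset q (hmat r ** g)" "0 < h$1$1" "h$1$1 \<le> 1" "0 = h$2$1 / h$1$1"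
    unfolding slopes_iff by blast
  then show ?thesis
    by (intro horizontal_section SL2_mult SL2_hmat g) auto
qed

section \<open>Existence of slopes of either sign\<close>

lemma zero_slope: "p \<in> BCZ_triangle q \<Longrightarrow> 0 \<in> slopes q (gp p)"
  using slopesI[OF Gq.Gq_one, of "gp p" q] triangle_pos[of p] by (simp add: gmat_def)

text \<open>The values \<open>x k\<close> are the first coordinates of the images under
  \<open>gmat a b\<close> of the first columns of \<open>Amat q k\<close>. They exceed 1 at k = 1
  and equal b \<le> 1 at k = q - 1; the first one that is at most 1 turns out to be still positive,
  so its vector lies in the strip.\<close>

lemma first_short_vector:
  assumes "(a, b) \<in> BCZ_triangle q"
  shows "\<exists>k\<ge>2. k \<le> q - 1 \<and> 1 < a * usin q k + b * usin q (k - 1) \<and>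
      0 < a * usin q (k + 1) + b * usin q k \<and> a * usin q (k + 1) + b * usin q k \<le> 1"
proof -
  define x where "x k = a * usin q (k + 1) + b * usin q k" for k
  have ab: "0 < a" "a \<le> 1" "1 < lambda_q q * a + b" "b \<le> 1"
    using assms by (auto simp: BCZ_triangle_def)
  have x1: "1 < x 1" using ab usin_2[OF q3] usin_1[OF q3] by (simp add: x_def numeral_2_eq_2 mult.commute)
  have "q - 1 + 1 = q" using q3 by simp
  then have xq: "x (q - 1) = b" unfolding x_def by (simp only: usin_q[OF q3] usin_q_minus_1[OF q3])
  define k where "k = (LEAST k. 1 \<le> k \<and> x k \<le> 1)"
  have ex: "1 \<le> q - 1 \<and> x (q - 1) \<le> 1" using q3 xq ab by simp
  have k: "1 \<le> k" "x k \<le> 1" "k \<le> q - 1"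
    unfolding k_def using LeastI[of "\<lambda>k. 1 \<le> k \<and> x k \<le> 1", OF ex] Least_le[of "\<lambda>k. 1 \<le> k \<and> x k \<le> 1", OF ex]
    by auto
  then have k2: "2 \<le> k" using x1 by (cases "k = 1") auto
  have km: "1 < x (k - 1)"
    using not_less_Least[of "k - 1" "\<lambda>k. 1 \<le> k \<and> x k \<le> 1"] k2 unfolding k_def[symmetric] by auto
  obtain j where j: "k = Suc j" using k2 by (cases k) auto
  have "usin q k * x (k - 1) - usin q (k - 1) * x k =
    a * (usin q (j + 1) * usin q (j + 1) - usin q j * usin q (j + 2))"
    by (simp add: x_def j algebra_simps)
  \<comment> \<open>If \<open>x k\<close> were nonpositive, this identity together with
    \<open>x (k - 1)\<close> > 1 would force a > 1.\<close>
  then have id: "a = usin q k * x (k - 1) - usin q (k - 1) * x k" by (simp only: usin_det[OF q3])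
  have u: "1 \<le> usin q k" "1 \<le> usin q (k - 1)" using usin_ge_1[OF q3] k k2 q3 by auto
  have "0 < x k"
  proof (rule ccontr)
    assume "\<not> 0 < x k"
    then have "usin q (k - 1) * x k \<le> 0" using u by (intro mult_nonneg_nonpos) auto
    moreover have "1 * 1 < usin q k * x (k - 1)" using u km by (intro mult_le_less_imp_less) auto
    ultimately show False using id ab by simp
  qed
  then show ?thesis using k k2 km by (intro exI[of _ k]) (auto simp: x_def)
qed

lemma usin_slope:
  assumes "0 < a" "0 < a * usin q (k + 1) + b * usin q k" "a * usin q (k + 1) + b * usin q k \<le> 1"
  shows "usin q k / (a * (a * usin q (k + 1) + b * usin q k)) \<in> slopes q (gmat a b)"
  using slopesI[OF Amat_Gq[OF q3, of k], of "gmat a b"] assms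
  by (simp add: mult_nth gmat_def Amat_def)

lemma positive_slope:
  assumes "p \<in> BCZ_triangle q" shows "\<exists>r\<in>slopes q (gp p). 0 < r"
proof -
  obtain a b where p: "p = (a, b)" by fastforce
  obtain k where k: "2 \<le> k" "k \<le> q - 1" "0 < a * usin q (k + 1) + b * usin q k"
     "a * usin q (k + 1) + b * usin q k \<le> 1"
    using first_short_vector[of a b] assms p by blast
  have "0 < a" using assms p by (simp add: BCZ_triangle_def)
  moreover have "0 < usin q k" using usin_ge_1[OF q3, of k] k q3 by force
  ultimately show ?thesis using usin_slope[OF _ k(3,4)] k(3) p
    by (intro bexI[of _ "usin q k / (a * (a * usin q (k + 1) + b * usin q k))"]) auto
qed

text \<open>A positive slope of \<open>gmat a (- b)\<close> is carried over by
  \<open>reflect\<close>. The point (a, -b) may lie outside the triangle, so it is first replaced by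
  a point of the section with the same coset.\<close>

lemma negative_slope:
  assumes "p \<in> BCZ_triangle q" shows "\<exists>r\<in>slopes q (gp p). r < 0"
proof -
  obtain a b where p: "p = (a, b)" by fastforce
  have a: "0 < a" "a \<le> 1" using assms p by (auto simp: BCZ_triangle_def)
  have "\<exists>p'\<in>BCZ_triangle q. coset q (gmat a (- b)) = coset q (gp p')"
    using a by (intro horizontal_section[of _ "gmat a (- b)"] coset_self SL2_gmat) (auto simp: gmat_def)
  then obtain r where "r \<in> slopes q (gmat a (- b))" "0 < r"
    using positive_slope slopes_cong by metis
  then obtain \<gamma> where \<gamma>: "\<gamma> \<in> Gq q" "0 < (gmat a (-b) ** \<gamma>)$1$1" "(gmat a (-b) ** \<gamma>)$1$1 \<le> 1"
      "r = (gmat a (-b) ** \<gamma>)$2$1 / (gmat a (-b) ** \<gamma>)$1$1"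
    unfolding slopes_iff coset_def by blast
  have e: "(gmat a b ** reflect \<gamma>)$1$1 = (gmat a (-b) ** \<gamma>)$1$1" "(gmat a b ** reflect \<gamma>)$2$1 = - (gmat a (-b) ** \<gamma>)$2$1"
    by (simp_all add: mult_nth gmat_def reflect_def)
  have "- r \<in> slopes q (gmat a b)"
    using slopesI[OF reflect_Gq[OF \<gamma>(1)], of "gmat a b"] \<gamma> by (simp add: e)
  then show ?thesis using p \<open>0 < r\<close> by (intro bexI[of _ "- r"]) auto
qed

section \<open>Return time and return map\<close>

lemma Rq_props:
  assumes p: "p \<in> BCZ_triangle q"
  shows "Rq q p \<in> slopes q (gp p)" "1 \<le> Rq q p" "r \<in> slopes q (gp p) \<Longrightarrow> 0 < r \<Longrightarrow> Rq q p \<le> r"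
proof -
  let ?A = "{r \<in> slopes q (gp p). 0 < r}"
  have "\<exists>m\<in>?A. \<forall>x\<in>?A. m \<le> x"
    using positive_slope[OF p] slopes_separated[OF gp_SL2[OF p]]
    by (intro separated_has_min[of _ 0]) auto
  then obtain m where m: "m \<in> slopes q (gp p)" "0 < m" "\<And>x. x \<in> slopes q (gp p) \<Longrightarrow> 0 < x \<Longrightarrow> m \<le> x"
    by blast
  have R: "Rq q p = m" unfolding Rq_Least using m by (intro Least_equality) auto
  show "Rq q p \<in> slopes q (gp p)" using R m by simp
  \<comment> \<open>0 is a slope too, so separation keeps the first positive slope at distance at
    least 1 from it.\<close>
  show "1 \<le> Rq q p" using R m slopes_separated[OF gp_SL2[OF p] zero_slope[OF p] m(1,2)] by simp
  show "r \<in> slopes q (gp p) \<Longrightarrow> 0 < r \<Longrightarrow> Rq q p \<le> r" using R m by simp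
qed

text \<open>\<open>BCZ\<close> is described through lattices, whereas \<open>Phi\<close> takes
  values in cosets. \<open>slope_section\<close> supplies a point with the right coset, and
  \<open>triangle_unique\<close> shows that the description by lattices denotes that point.\<close>

lemma BCZ_props:
  assumes p: "p \<in> BCZ_triangle q"
  shows "BCZ q p \<in> BCZ_triangle q" "coset q (hmat (Rq q p) ** gp p) = coset q (gp (BCZ q p))"
proof -
  obtain p' where p': "p' \<in> BCZ_triangle q" "coset q (hmat (Rq q p) ** gp p) = coset q (gp p')"
    using slope_section[OF gp_SL2[OF p] Rq_props(1)[OF p]] by blast
  then have gl: "glat q (hmat (Rq q p) ** gp p) = glat q (gp p')" by (auto simp: glat_iff)
  have "BCZ q p = p'" unfolding BCZ_def
  proof (rule the_equality)
    show "p'' = p'" if "p'' \<in> BCZ_triangle q \<and> glat q (hmat (Rq q p) ** gp p) = glat q (gp p'')" for p''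
      using that gl by (intro triangle_unique p'(1)) simp_all
  qed (use p' gl in simp)
  then show "BCZ q p \<in> BCZ_triangle q" "coset q (hmat (Rq q p) ** gp p) = coset q (gp (BCZ q p))"
    using p' by auto
qed

section \<open>Bijection between the suspension and the cosets meeting the strip\<close>

lemma slopes_unbounded_below:
  assumes g: "g \<in> SL2" and ne: "slopes q g \<noteq> {}"
  shows "\<exists>r\<in>slopes q g. r \<le> c"
proof -
  obtain r0 where r0: "r0 \<in> slopes q g" using ne by blast
  have step: "\<exists>r'\<in>slopes q g. r' \<le> r - 1" if r: "r \<in> slopes q g" for r
  proof -
    obtain p where p: "p \<in> BCZ_triangle q" "coset q (hmat r ** g) = coset q (gp p)"
      using slope_section[OF g r] by blast
    obtain s where "s \<in> slopes q (gp p)" "s < 0" using negative_slope[OF p(1)] by blast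
    then have "s + r \<in> slopes q g" using slopes_cong[OF p(2)] slopes_hmat by blast
    then show ?thesis using slopes_separated[OF g _ r, of "s + r"] \<open>s < 0\<close> by (intro bexI[of _ "s + r"]) auto
  qed
  have "\<exists>r\<in>slopes q g. r \<le> r0 - real n" for n
  proof (induction n)
    case 0 then show ?case using r0 by auto
  next
    case (Suc n)
    then obtain r where r: "r \<in> slopes q g" "r \<le> r0 - real n" by blast
    from step[OF r(1)] obtain r' where "r' \<in> slopes q g" "r' \<le> r - 1" by blast
    then show ?case using r by (intro bexI[of _ r']) auto
  qed
  moreover obtain n where "r0 - c \<le> real n" using real_arch_simple by blast
  ultimately obtain r where "r \<in> slopes q g" "r \<le> r0 - real n" by blast
  then show ?thesis using \<open>r0 - c \<le> real n\<close> by (intro bexI[of _ r]) auto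
qed

text \<open>This is the invariant set of full measure that the theorem asserts.\<close>

definition hits :: "mat2 set set" where
  "hits = {coset q g | g. g \<in> SL2 \<and> slopes q g \<noteq> {}}"

lemma coset_hits_iff: "g \<in> SL2 \<Longrightarrow> coset q g \<in> hits \<longleftrightarrow> slopes q g \<noteq> {}"
  unfolding hits_def using slopes_cong by blast

text \<open>The largest nonpositive slope m determines the point: shearing by m makes its vector
  horizontal, which gives p, and the height is -m. Adding the roof of p to m gives a slope above m,
  which must be positive; so the height is below the roof.\<close>

lemma Phi_surj: assumes g: "g \<in> SL2" and ne: "slopes q g \<noteq> {}"
  shows "\<exists>y\<in>Yq q. Phi q y = coset q g"
proof -
  let ?A = "uminus ` {r \<in> slopes q g. r \<le> 0}"
  have "\<exists>m\<in>?A. \<forall>x\<in>?A. m \<le> x"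
  proof (rule separated_has_min[of _ 0])
    show "?A \<noteq> {}" using slopes_unbounded_below[OF g ne, of 0] by auto
    show "x + 1 \<le> y" if "x \<in> ?A" "y \<in> ?A" "x < y" for x y
      using that slopes_separated[OF g, of "- y" "- x"] by auto
  qed auto
  then obtain m where m: "m \<in> slopes q g" "m \<le> 0" "\<And>x. x \<in> slopes q g \<Longrightarrow> x \<le> 0 \<Longrightarrow> x \<le> m" by auto
  obtain p where p: "p \<in> BCZ_triangle q" "coset q (hmat m ** g) = coset q (gp p)"
    using slope_section[OF g m(1)] by blast
  have "Rq q p + m \<in> slopes q g"
    using Rq_props(1)[OF p(1)] slopes_cong[OF p(2)] slopes_hmat by blast
  then have "- m < Rq q p" using m(3)[of "Rq q p + m"] Rq_props(2)[OF p(1)] by force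
  then have y: "(p, - m) \<in> Yq q" using p m by (simp add: Yq_def)
  have "Phi q (p, - m) = lmul (hmat (- m)) (coset q (gp p))" by (simp add: Phi_def lmul_coset)
  also have "\<dots> = coset q g"
    unfolding p(2)[symmetric] lmul_coset by (simp add: matrix_mul_assoc hmat_add hmat_0)
  finally show ?thesis using y by blast
qed

lemma Phi_hits: "y \<in> Yq q \<Longrightarrow> Phi q y \<in> hits"
proof -
  assume y: "y \<in> Yq q"
  obtain p s where ps: "y = (p, s)" by fastforce
  have p: "p \<in> BCZ_triangle q" using y ps by (simp add: Yq_def)
  have "- s \<in> slopes q (hmat s ** gp p)" using zero_slope[OF p] by (simp add: slopes_hmat)
  then show ?thesis unfolding Phi_def hits_def ps using SL2_mult[OF SL2_hmat gp_SL2[OF p], of s] by auto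
qed

lemma coset_hmat_cancel:
  assumes "coset q (hmat s ** g) = coset q (hmat s ** g')" shows "coset q g = coset q g'"
proof -
  have "lmul (hmat (- s)) (coset q (hmat s ** g)) = lmul (hmat (- s)) (coset q (hmat s ** g'))"
    using assms by simp
  then show ?thesis unfolding lmul_coset by (simp add: matrix_mul_assoc hmat_add hmat_0)
qed

text \<open>The negatives of both heights are slopes of the common coset. A nonzero difference of
  the heights would be a positive slope, below the roof, over one of the base points. Hence the
  heights agree, and so do the lattices of the base points.\<close>

lemma Phi_inj: "inj_on (Phi q) (Yq q)"
proof (rule inj_onI)
  fix y y' assume y: "y \<in> Yq q" and y': "y' \<in> Yq q" and eq: "Phi q y = Phi q y'"
  obtain p s p' s' where ps: "y = (p, s)" "y' = (p', s')" by fastforce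
  have p: "p \<in> BCZ_triangle q" "0 \<le> s" "s < Rq q p" and p': "p' \<in> BCZ_triangle q" "0 \<le> s'" "s' < Rq q p'"
    using y y' ps by (auto simp: Yq_def)
  have eq': "coset q (hmat s ** gp p) = coset q (hmat s' ** gp p')" using eq by (simp add: Phi_def ps)
  note sl = slopes_cong[OF eq']
  have "- s \<in> slopes q (hmat s ** gp p)" "- s' \<in> slopes q (hmat s' ** gp p')"
    using zero_slope p(1) p'(1) by (simp_all add: slopes_hmat)
  then have "- s \<in> slopes q (hmat s' ** gp p')" "- s' \<in> slopes q (hmat s ** gp p)" using sl by auto
  then have "s' - s \<in> slopes q (gp p')" "s - s' \<in> slopes q (gp p)" by (simp_all add: slopes_hmat)
  then have "s = s'" using Rq_props(3)[OF p(1), of "s - s'"] Rq_props(3)[OF p'(1), of "s' - s"] p p' by force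
  then have "coset q (gp p) = coset q (gp p')" using eq' coset_hmat_cancel by blast
  then have "glat q (gp p) = glat q (gp p')" by (auto simp: glat_iff)
  then show "y = y'" using triangle_unique p p' ps \<open>s = s'\<close> by simp
qed

lemma Phi_bij: "bij_betw (Phi q) (Yq q) hits"
proof -
  have "hits \<subseteq> Phi q ` Yq q" unfolding hits_def using Phi_surj by blast
  then show ?thesis unfolding bij_betw_def using Phi_inj Phi_hits by auto
qed

lemma hflow_hits: "hflow t ` hits = hits"
proof -
  have sub: "hflow t x \<in> hits" if x: "x \<in> hits" for t x
  proof -
    obtain g r where g: "x = coset q g" "g \<in> SL2" "r \<in> slopes q g" using x unfolding hits_def by blast
    then have "r - t \<in> slopes q (hmat t ** g)" by (simp add: slopes_hmat)
    then show ?thesis unfolding hflow_def g(1) lmul_coset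
      using coset_hits_iff[OF SL2_mult[OF SL2_hmat g(2)]] by blast
  qed
  have "x \<in> hflow t ` hits" if x: "x \<in> hits" for x
  proof -
    have "hflow t (hflow (- t) x) = x"
      using x unfolding hits_def hflow_def by (auto simp: lmul_coset matrix_mul_assoc hmat_add hmat_0)
    then show ?thesis using sub[OF x, of "- t"] by (metis image_eqI)
  qed
  then show ?thesis using sub by blast
qed

section \<open>Conjugacy of the suspension flow with the horocycle flow\<close>

lemma BCZ_iterate:
  assumes p: "p \<in> BCZ_triangle q"
  shows "(BCZ q ^^ n) p \<in> BCZ_triangle q \<and> coset q (hmat (ret q p n) ** gp p) = coset q (gp ((BCZ q ^^ n) p))"
proof (induction n)
  case 0 then show ?case using p by (simp add: ret_def hmat_0)
next
  case (Suc n)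
  let ?p = "(BCZ q ^^ n) p"
  have "coset q (hmat (ret q p (Suc n)) ** gp p) = lmul (hmat (Rq q ?p)) (coset q (hmat (ret q p n) ** gp p))"
    unfolding lmul_coset by (simp add: matrix_mul_assoc hmat_add ret_def add.commute)
  also have "\<dots> = coset q (hmat (Rq q ?p) ** gp ?p)" using Suc by (simp add: lmul_coset)
  finally show ?case using BCZ_props[of ?p] Suc by simp
qed

lemma ret_step: "p \<in> BCZ_triangle q \<Longrightarrow> ret q p n + 1 \<le> ret q p (Suc n)"
  using BCZ_iterate[of p n] Rq_props(2)[of "(BCZ q ^^ n) p"] by (simp add: ret_def)

lemma ret_mono: assumes "p \<in> BCZ_triangle q" "m \<le> n" shows "ret q p m \<le> ret q p n"
  using assms(2)
proof (rule lift_Suc_mono_le[rotated])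
  show "ret q p k \<le> ret q p (Suc k)" for k using ret_step[OF assms(1), of k] by simp
qed

lemma ret_ge: "p \<in> BCZ_triangle q \<Longrightarrow> real n \<le> ret q p n"
proof (induction n)
  case 0 then show ?case by (simp add: ret_def)
next
  case (Suc n) then show ?case using ret_step[of p n] by simp
qed

lemma susp_flow_conj:
  assumes t: "0 \<le> t" and y: "y \<in> Yq q"
  shows "Phi q (susp_flow q t y) = hflow t (Phi q y)"
proof -
  obtain p s where ps: "y = (p, s)" by fastforce
  have p: "p \<in> BCZ_triangle q" and s: "0 \<le> s" using y ps by (auto simp: Yq_def)
  obtain N where "s + t < real N" using reals_Archimedean2 by blast
  then have ex: "s + t < ret q p N" using ret_ge[OF p, of N] by simp
  \<comment> \<open>Return times grow by at least 1, so some exceed s + t. The predecessor of the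
    first such index is the one that the suspension flow selects.\<close>
  define k where "k = (LEAST k. s + t < ret q p k)"
  have k: "s + t < ret q p k" unfolding k_def using ex by (rule LeastI)
  then have "k \<noteq> 0" using s t by (intro notI) (simp add: ret_def)
  then obtain n where n: "k = Suc n" by (cases k) auto
  have n1: "ret q p n \<le> s + t"
    using not_less_Least[of n "\<lambda>k. s + t < ret q p k"] n k_def by simp
  have "(THE n. ret q p n \<le> s + t \<and> s + t < ret q p (Suc n)) = n"
  proof (rule the_equality)
    show "ret q p n \<le> s + t \<and> s + t < ret q p (Suc n)" using n1 k n by simp
    fix m assume m: "ret q p m \<le> s + t \<and> s + t < ret q p (Suc m)"
    show "m = n"
    proof (rule ccontr)
      assume "m \<noteq> n"
      then consider "Suc m \<le> n" | "Suc n \<le> m" by linarith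
      then show False
        using ret_mono[OF p, of "Suc m" n] ret_mono[OF p, of "Suc n" m] m n1 k n by cases auto
    qed
  qed
  then have "susp_flow q t y = ((BCZ q ^^ n) p, s + t - ret q p n)"
    unfolding susp_flow_def Let_def ps by simp
  then have "Phi q (susp_flow q t y) = lmul (hmat (s + t - ret q p n)) (coset q (gp ((BCZ q ^^ n) p)))"
    by (simp add: Phi_def lmul_coset)
  also have "\<dots> = lmul (hmat (s + t - ret q p n)) (coset q (hmat (ret q p n) ** gp p))"
    using BCZ_iterate[OF p, of n] by simp
  also have "\<dots> = hflow t (Phi q y)"
    unfolding lmul_coset hflow_def Phi_def ps by (simp add: matrix_mul_assoc hmat_add add.commute)
  finally show ?thesis .
qed

end

section \<open>Haar measure on the special linear group\<close>

lemma measurable_entry [measurable]: "(\<lambda>A::mat2. A $ i $ j) \<in> borel_measurable borel"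
  by (intro borel_measurable_continuous_onI continuous_intros)

lemma measurable_mat2 [measurable (raw)]:
  assumes [measurable]: "f \<in> borel_measurable M" "g \<in> borel_measurable M" "h \<in> borel_measurable M" "k \<in> borel_measurable M"
  shows "(\<lambda>x. mat2 (f x) (g x) (h x) (k x)) \<in> borel_measurable M"
proof -
  have "(\<lambda>x. mat2 (f x) (g x) (h x) (k x)) =
      (\<lambda>x. f x *\<^sub>R mat2 1 0 0 0 + g x *\<^sub>R mat2 0 1 0 0 + h x *\<^sub>R mat2 0 0 1 0 + k x *\<^sub>R mat2 0 0 0 1)"
    by (simp add: mat2_eq_iff fun_eq_iff)
  also have "\<dots> \<in> borel_measurable M" by measurable
  finally show ?thesis .
qed

lemma measurable_mat2_mult [measurable (raw)]:
  fixes f g :: "'a \<Rightarrow> mat2"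
  assumes [measurable]: "f \<in> borel_measurable M" "g \<in> borel_measurable M"
  shows "(\<lambda>x. f x ** g x) \<in> borel_measurable M"
proof -
  have "A ** B = mat2 (A$1$1 * B$1$1 + A$1$2 * B$2$1) (A$1$1 * B$1$2 + A$1$2 * B$2$2)
     (A$2$1 * B$1$1 + A$2$2 * B$2$1) (A$2$1 * B$1$2 + A$2$2 * B$2$2)" for A B :: mat2
    by (simp add: mat2_eq_iff mult_nth)
  then show ?thesis by simp
qed

lemma measurable_minv [measurable]: "minv \<in> borel_measurable borel"
  unfolding minv_def[abs_def] by measurable

lemma SL2_borel [measurable]: "SL2 \<in> sets borel"
proof -
  have "SL2 = {A \<in> space borel. A$1$1 * A$2$2 - A$1$2 * A$2$1 = (1::real)}"
    by (auto simp: SL2_iff)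
  also have "\<dots> \<in> sets borel" by measurable
  finally show ?thesis .
qed

text \<open>Coordinates on the matrices with nonzero upper left entry, in which Haar measure is
  Lebesgue measure.\<close>

definition psi :: "(real \<times> real) \<times> real \<Rightarrow> mat2" where
  "psi y = hmat (snd y) ** gmat (fst (fst y)) (snd (fst y))"

text \<open>A functional on all functions of matrices. At a = 0, where \<open>1 / a\<close> is 0,
  \<open>psi\<close> leaves \<open>SL2\<close>; these coordinates form a null set.\<close>

definition haar :: "(mat2 \<Rightarrow> ennreal) \<Rightarrow> ennreal" where
  "haar f = (\<integral>\<^sup>+y. f (psi y) \<partial>lborel)"

lemma psi_eq: "psi ((a, b), s) = mat2 a b (- s * a) (1 / a - s * b)"
  by (simp add: psi_def hmat_def gmat_def mat2_eq_iff mult_nth)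

lemma measurable_psi_pair [measurable (raw)]:
  assumes [measurable]: "f \<in> borel_measurable M" "g \<in> borel_measurable M" "h \<in> borel_measurable M"
  shows "(\<lambda>x. psi ((f x, g x), h x)) \<in> borel_measurable M"
  unfolding psi_eq by measurable

lemma measurable_psi [measurable]: "psi \<in> borel_measurable borel"
proof -
  have "(\<lambda>y. psi ((fst (fst y), snd (fst y)), snd y)) \<in> borel_measurable ((borel \<Otimes>\<^sub>M borel) \<Otimes>\<^sub>M borel)"
    by measurable
  then show ?thesis by (simp add: borel_prod)
qed

lemma AE_lborel_neq: "AE x in lborel. x \<noteq> (c::real)"
  by (rule AE_I[of _ _ "{c}"]) auto

lemma nn_integral_affine:
  fixes c t :: real
  assumes [measurable]: "f \<in> borel_measurable borel" and c: "c \<noteq> 0"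
  shows "(\<integral>\<^sup>+x. f (t + c * x) \<partial>lborel) = ennreal (1 / \<bar>c\<bar>) * (\<integral>\<^sup>+x. f x \<partial>lborel)"
proof -
  have "ennreal (1 / \<bar>c\<bar>) * (\<integral>\<^sup>+x. f x \<partial>lborel) = ennreal (1 / \<bar>c\<bar>) * (ennreal \<bar>c\<bar> * (\<integral>\<^sup>+x. f (t + c * x) \<partial>lborel))"
    by (subst nn_integral_real_affine[OF assms, of t]) simp
  also have "\<dots> = ennreal (1 / \<bar>c\<bar> * \<bar>c\<bar>) * (\<integral>\<^sup>+x. f (t + c * x) \<partial>lborel)"
    by (subst ennreal_mult) (auto simp: mult.assoc)
  also have "\<dots> = (\<integral>\<^sup>+x. f (t + c * x) \<partial>lborel)" using c by simp
  finally show ?thesis ..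
qed

lemma nn_integral_translate:
  fixes t :: real
  assumes "f \<in> borel_measurable borel"
  shows "(\<integral>\<^sup>+x. f (x + t) \<partial>lborel) = (\<integral>\<^sup>+x. f x \<partial>lborel)"
  using nn_integral_affine[OF assms, of 1 t] by (simp add: add.commute)

lemma nn_integral_lborel_pair:
  fixes f :: "'a::euclidean_space \<times> 'b::euclidean_space \<Rightarrow> ennreal"
  assumes "f \<in> borel_measurable borel"
  shows "(\<integral>\<^sup>+x. f x \<partial>lborel) = (\<integral>\<^sup>+x. \<integral>\<^sup>+y. f (x, y) \<partial>lborel \<partial>lborel)"
  unfolding lborel_prod[symmetric] by (rule lborel.nn_integral_fst[symmetric]) (simp add: lborel_prod assms)

lemma nn_integral_lborel_swap:
  fixes f :: "'a::euclidean_space \<Rightarrow> 'b::euclidean_space \<Rightarrow> ennreal"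
  assumes "case_prod f \<in> borel_measurable (borel \<Otimes>\<^sub>M borel)"
  shows "(\<integral>\<^sup>+x. \<integral>\<^sup>+y. f x y \<partial>lborel \<partial>lborel) = (\<integral>\<^sup>+y. \<integral>\<^sup>+x. f x y \<partial>lborel \<partial>lborel)"
  using assms by (intro lborel_pair.Fubini'[symmetric]) (simp add: lborel_prod borel_prod)

lemma haar_iterated:
  assumes [measurable]: "f \<in> borel_measurable borel"
  shows "haar f = (\<integral>\<^sup>+a. \<integral>\<^sup>+b. \<integral>\<^sup>+s. f (psi ((a, b), s)) \<partial>lborel \<partial>lborel \<partial>lborel)"
proof -
  have "haar f = (\<integral>\<^sup>+p. \<integral>\<^sup>+s. f (psi (p, s)) \<partial>lborel \<partial>lborel)"
    unfolding haar_def by (rule nn_integral_lborel_pair) measurable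
  also have "\<dots> = (\<integral>\<^sup>+a. \<integral>\<^sup>+b. \<integral>\<^sup>+s. f (psi ((a, b), s)) \<partial>lborel \<partial>lborel \<partial>lborel)"
  proof (rule nn_integral_lborel_pair)
    have "(\<lambda>p. f (psi (fst p, snd p))) \<in> borel_measurable borel" by simp
    then have "(\<lambda>(p, s). f (psi (p, s))) \<in> borel_measurable (borel \<Otimes>\<^sub>M lborel)"
      by (subst measurable_cong_sets[OF sets_pair_measure_cong[OF refl sets_lborel] refl])
        (simp add: case_prod_unfold borel_prod)
    then show "(\<lambda>p. \<integral>\<^sup>+s. f (psi (p, s)) \<partial>lborel) \<in> borel_measurable borel"
      by (rule lborel.borel_measurable_nn_integral)
  qed
  finally show ?thesis .
qed

lemma haar_iterated':
  assumes [measurable]: "f \<in> borel_measurable borel"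
  shows "haar f = (\<integral>\<^sup>+b. \<integral>\<^sup>+a. \<integral>\<^sup>+s. f (psi ((a, b), s)) \<partial>lborel \<partial>lborel \<partial>lborel)"
  unfolding haar_iterated[OF assms] by (rule nn_integral_lborel_swap) measurable

text \<open>The substitution c = - s a gives the same integral in the coordinates a, b, c with
  density 1 / |a|. In these, left multiplication by \<open>umat t\<close> fixes c and is affine in
  b.\<close>

lemma haar_chart:
  assumes [measurable]: "f \<in> borel_measurable borel"
  shows "haar f = (\<integral>\<^sup>+c. \<integral>\<^sup>+a. ennreal (1 / \<bar>a\<bar>) * (\<integral>\<^sup>+b. f (mat2 a b c ((1 + b * c) / a)) \<partial>lborel) \<partial>lborel \<partial>lborel)"
proof -
  have "(\<integral>\<^sup>+s. f (psi ((a, b), s)) \<partial>lborel) = ennreal (1 / \<bar>a\<bar>) * (\<integral>\<^sup>+c. f (mat2 a b c ((1 + b * c) / a)) \<partial>lborel)"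
    if "a \<noteq> 0" for a b
  proof -
    have "(\<integral>\<^sup>+s. f (psi ((a, b), s)) \<partial>lborel) =
      (\<integral>\<^sup>+s. (\<lambda>c. f (mat2 a b c ((1 + b * c) / a))) (0 + (- a) * s) \<partial>lborel)"
      using that by (intro nn_integral_cong) (simp add: psi_eq field_simps)
    also have "\<dots> = ennreal (1 / \<bar>- a\<bar>) * (\<integral>\<^sup>+c. f (mat2 a b c ((1 + b * c) / a)) \<partial>lborel)"
      using that by (intro nn_integral_affine) auto
    finally show ?thesis by simp
  qed
  then have "haar f = (\<integral>\<^sup>+a. \<integral>\<^sup>+b. ennreal (1 / \<bar>a\<bar>) * (\<integral>\<^sup>+c. f (mat2 a b c ((1 + b * c) / a)) \<partial>lborel) \<partial>lborel \<partial>lborel)"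
    unfolding haar_iterated[OF assms] using AE_lborel_neq[of 0]
    by (intro nn_integral_cong_AE) (auto elim!: eventually_mono)
  also have "\<dots> = (\<integral>\<^sup>+a. \<integral>\<^sup>+b. \<integral>\<^sup>+c. ennreal (1 / \<bar>a\<bar>) * f (mat2 a b c ((1 + b * c) / a)) \<partial>lborel \<partial>lborel \<partial>lborel)"
    by (subst nn_integral_cmult[symmetric], measurable)
  also have "\<dots> = (\<integral>\<^sup>+a. \<integral>\<^sup>+c. \<integral>\<^sup>+b. ennreal (1 / \<bar>a\<bar>) * f (mat2 a b c ((1 + b * c) / a)) \<partial>lborel \<partial>lborel \<partial>lborel)"
    by (rule nn_integral_cong, rule nn_integral_lborel_swap) measurable
  also have "\<dots> = (\<integral>\<^sup>+c. \<integral>\<^sup>+a. \<integral>\<^sup>+b. ennreal (1 / \<bar>a\<bar>) * f (mat2 a b c ((1 + b * c) / a)) \<partial>lborel \<partial>lborel \<partial>lborel)"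
    by (rule nn_integral_lborel_swap) measurable
  also have "\<dots> = (\<integral>\<^sup>+c. \<integral>\<^sup>+a. ennreal (1 / \<bar>a\<bar>) * (\<integral>\<^sup>+b. f (mat2 a b c ((1 + b * c) / a)) \<partial>lborel) \<partial>lborel \<partial>lborel)"
    by (subst nn_integral_cmult, measurable)
  finally show ?thesis .
qed

section \<open>Two-sided invariance\<close>

definition umat :: "real \<Rightarrow> mat2" where "umat t = mat2 1 t 0 1"

text \<open>A matrix with nonzero lower left entry is a product upper, lower, upper of unipotent
  matrices, and multiplication by \<open>hmat 1\<close> reduces the other case to it. Invariance
  thus has to be checked on \<open>umat\<close> and \<open>hmat\<close> only.\<close>

lemma SL2_unipotent_induct:
  assumes g: "g \<in> SL2" and mult: "\<And>A B. P A \<Longrightarrow> P B \<Longrightarrow> P (A ** B)"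
    and u: "\<And>t. P (umat t)" and h: "\<And>t. P (hmat t)"
  shows "P g"
proof -
  have *: "P A" if A: "A \<in> SL2" "A$2$1 \<noteq> 0" for A
  proof -
    have "A = umat ((A$1$1 - 1) / A$2$1) ** hmat (- A$2$1) ** umat ((A$2$2 - 1) / A$2$1)"
      using A by (simp add: SL2_iff mat2_eq_iff mult_nth umat_def hmat_def field_simps)
    then show ?thesis using mult u h by metis
  qed
  show ?thesis
  proof (cases "g$2$1 = 0")
    case True
    have "g$2$2 \<noteq> 0" using g True by (auto simp: SL2_iff)
    then have "P (g ** hmat 1)"
      using True by (intro * SL2_mult g SL2_hmat) (simp add: mult_nth hmat_def)
    then have "P (g ** hmat 1 ** hmat (- 1))" using mult h by blast
    then show ?thesis by (simp add: hmat_add hmat_0 flip: matrix_mul_assoc)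
  qed (use * g in blast)
qed

lemma haar_right_umat:
  assumes [measurable]: "f \<in> borel_measurable borel"
  shows "haar (\<lambda>x. f (x ** umat t)) = haar f"
proof -
  have e: "psi ((a, b), s) ** umat t = psi ((a, b + t * a), s)" for a b s
    by (simp add: psi_eq umat_def mat2_eq_iff mult_nth algebra_simps)
  have "haar (\<lambda>x. f (x ** umat t)) = (\<integral>\<^sup>+a. \<integral>\<^sup>+b. (\<integral>\<^sup>+s. f (psi ((a, b + t * a), s)) \<partial>lborel) \<partial>lborel \<partial>lborel)"
    by (subst haar_iterated, measurable) (simp add: e)
  also have "\<dots> = haar f"
    unfolding haar_iterated[OF assms]
    by (intro nn_integral_cong nn_integral_translate) measurable
  finally show ?thesis .
qed

text \<open>For fixed b this is a translation of a by - t b together with a shift of s, which is why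
  b is integrated outermost. The values a = 0 and a = t b, where the formula breaks down, are
  negligible.\<close>

lemma haar_right_hmat:
  assumes [measurable]: "f \<in> borel_measurable borel"
  shows "haar (\<lambda>x. f (x ** hmat t)) = haar f"
proof -
  have "(\<integral>\<^sup>+s. f (psi ((a, b), s) ** hmat t) \<partial>lborel) = (\<integral>\<^sup>+s. f (psi ((a - t * b, b), s)) \<partial>lborel)"
    if "a \<noteq> 0" "a \<noteq> t * b" for a b
  proof -
    have e: "psi ((a, b), s) ** hmat t = psi ((a - t * b, b), s + t / (a * (a - t * b)))" for s
    proof -
      define w where "w = a - t * b"
      have w: "w \<noteq> 0" "t * b = a - w" using that by (auto simp: w_def)
      have "1 / w - (s + t / (a * w)) * b = 1 / w - s * b - t * b / (a * w)"
        by (simp add: algebra_simps)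
      also have "t * b / (a * w) = 1 / w - 1 / a"
        unfolding w(2) using w(1) that(1) by (simp add: diff_divide_distrib)
      finally have 1: "1 / w - (s + t / (a * w)) * b = 1 / w - s * b - (1 / w - 1 / a)" .
      have "- (s + t / (a * w)) * w = - s * w - t / a" using w that(1) by (simp add: field_simps)
      also have "\<dots> = - s * a - (1 / a - s * b) * t" by (simp add: w_def algebra_simps)
      finally have 2: "- (s + t / (a * w)) * w = - s * a - (1 / a - s * b) * t" .
      from 1 have 3: "1 / w - (s + t / (a * w)) * b = 1 / a - s * b" by simp
      show ?thesis unfolding w_def[symmetric] psi_eq 3 2
        by (simp add: hmat_def mat2_eq_iff mult_nth w_def)
    qed
    show ?thesis unfolding e
      by (rule nn_integral_translate[of "\<lambda>s. f (psi ((a - t * b, b), s))"]) measurable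
  qed
  then have "haar (\<lambda>x. f (x ** hmat t)) = (\<integral>\<^sup>+b. \<integral>\<^sup>+a. (\<integral>\<^sup>+s. f (psi ((a + (- t * b), b), s)) \<partial>lborel) \<partial>lborel \<partial>lborel)"
    apply (subst haar_iterated', measurable)
    apply (rule nn_integral_cong)
    subgoal for b
      using AE_lborel_neq[of 0] AE_lborel_neq[of "t * b"]
      by (intro nn_integral_cong_AE, eventually_elim) simp
    done
  also have "\<dots> = haar f"
    unfolding haar_iterated'[OF assms]
    by (intro nn_integral_cong nn_integral_translate) measurable
  finally show ?thesis .
qed

lemma haar_left_hmat:
  assumes [measurable]: "f \<in> borel_measurable borel"
  shows "haar (\<lambda>x. f (hmat t ** x)) = haar f"
proof -
  have e: "hmat t ** psi ((a, b), s) = psi ((a, b), s + t)" for a b s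
    by (simp add: psi_def matrix_mul_assoc hmat_add add.commute)
  have "haar (\<lambda>x. f (hmat t ** x)) = (\<integral>\<^sup>+a. \<integral>\<^sup>+b. \<integral>\<^sup>+s. f (psi ((a, b), s + t)) \<partial>lborel \<partial>lborel \<partial>lborel)"
    by (subst haar_iterated, measurable) (simp add: e)
  also have "\<dots> = haar f"
    unfolding haar_iterated[OF assms]
    by (intro nn_integral_cong nn_integral_translate) measurable
  finally show ?thesis .
qed

text \<open>In the chart c is fixed, a becomes a + t c, and b changes affinely with factor (a + t c)
  / a. The Jacobian turns the density 1 / |a| into 1 / |a + t c|, and a translation in a
  remains.\<close>

lemma haar_left_umat:
  assumes [measurable]: "f \<in> borel_measurable borel"
  shows "haar (\<lambda>x. f (umat t ** x)) = haar f"
proof -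
  let ?\<phi> = "\<lambda>c a b. f (mat2 a b c ((1 + b * c) / a))"
  have "ennreal (1 / \<bar>a\<bar>) * (\<integral>\<^sup>+b. f (umat t ** mat2 a b c ((1 + b * c) / a)) \<partial>lborel) =
      ennreal (1 / \<bar>a + t * c\<bar>) * (\<integral>\<^sup>+b. ?\<phi> c (a + t * c) b \<partial>lborel)"
    if a: "a \<noteq> 0" "a \<noteq> - t * c" for a c
  proof -
    have a': "a + t * c \<noteq> 0" using a by auto
    define w where "w = a + t * c"
    have w: "w \<noteq> 0" "t * c = w - a" using a' by (auto simp: w_def)
    have "umat t ** mat2 a b c ((1 + b * c) / a) =
        mat2 (a + t * c) (t / a + (a + t * c) / a * b) c ((1 + (t / a + (a + t * c) / a * b) * c) / (a + t * c))" for b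
    proof -
      have "(1 + (t / a + w / a * b) * c) / w = (1 + t * c / a + w / a * b * c) / w"
        by (simp add: algebra_simps)
      also have "1 + t * c / a + w / a * b * c = w * ((1 + b * c) / a)"
        unfolding w(2) using a(1) by (simp add: diff_divide_distrib algebra_simps add_divide_distrib)
      also have "w * ((1 + b * c) / a) / w = (1 + b * c) / a" using w(1) by simp
      finally have 1: "(1 + (t / a + w / a * b) * c) / w = (1 + b * c) / a" .
      have "t / a + w / a * b = b + t * ((1 + b * c) / a)"
        using a(1) by (simp add: w_def field_simps)
      then show ?thesis unfolding w_def[symmetric] 1
        by (simp add: umat_def mat2_eq_iff mult_nth w_def)
    qed
    then have "(\<integral>\<^sup>+b. f (umat t ** mat2 a b c ((1 + b * c) / a)) \<partial>lborel) =
        (\<integral>\<^sup>+b. ?\<phi> c (a + t * c) (t / a + (a + t * c) / a * b) \<partial>lborel)"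
      by simp
    also have "\<dots> = ennreal (1 / \<bar>(a + t * c) / a\<bar>) * (\<integral>\<^sup>+b. ?\<phi> c (a + t * c) b \<partial>lborel)"
      using a(1) a' by (intro nn_integral_affine) auto
    finally show ?thesis
      using a(1) by (simp add: mult.assoc[symmetric] ennreal_mult[symmetric] abs_divide)
  qed
  then have "haar (\<lambda>x. f (umat t ** x)) =
     (\<integral>\<^sup>+c. \<integral>\<^sup>+a. (\<lambda>a. ennreal (1 / \<bar>a\<bar>) * (\<integral>\<^sup>+b. ?\<phi> c a b \<partial>lborel)) (a + t * c) \<partial>lborel \<partial>lborel)"
    apply (subst haar_chart, measurable)
    apply (rule nn_integral_cong)
    subgoal for c
      using AE_lborel_neq[of 0] AE_lborel_neq[of "- t * c"]
      by (intro nn_integral_cong_AE, eventually_elim) simp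
    done
  also have "\<dots> = haar f"
    unfolding haar_chart[OF assms]
    by (intro nn_integral_cong nn_integral_translate) measurable
  finally show ?thesis .
qed

lemma haar_right_invariant:
  assumes "g \<in> SL2" "f \<in> borel_measurable borel"
  shows "haar (\<lambda>x. f (x ** g)) = haar f"
proof -
  have "\<forall>f\<in>borel_measurable borel. haar (\<lambda>x. f (x ** g)) = haar f"
    using assms(1)
  proof (rule SL2_unipotent_induct)
    fix A B :: mat2
    assume A: "\<forall>f\<in>borel_measurable borel. haar (\<lambda>x. f (x ** A)) = haar f"
       and B: "\<forall>f\<in>borel_measurable borel. haar (\<lambda>x. f (x ** B)) = haar f"
    show "\<forall>f\<in>borel_measurable borel. haar (\<lambda>x. f (x ** (A ** B))) = haar f"
    proof
      fix f :: "mat2 \<Rightarrow> ennreal" assume [measurable]: "f \<in> borel_measurable borel"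
      have "haar (\<lambda>x. f (x ** (A ** B))) = haar (\<lambda>x. (\<lambda>y. f (y ** B)) (x ** A))"
        by (simp add: matrix_mul_assoc)
      also have "\<dots> = haar (\<lambda>y. f (y ** B))" by (rule bspec[OF A]) measurable
      also have "\<dots> = haar f" by (rule bspec[OF B]) measurable
      finally show "haar (\<lambda>x. f (x ** (A ** B))) = haar f" .
    qed
  qed (simp_all add: haar_right_umat haar_right_hmat)
  then show ?thesis using assms(2) by blast
qed

lemma haar_left_invariant:
  assumes "g \<in> SL2" "f \<in> borel_measurable borel"
  shows "haar (\<lambda>x. f (g ** x)) = haar f"
proof -
  have "\<forall>f\<in>borel_measurable borel. haar (\<lambda>x. f (g ** x)) = haar f"
    using assms(1)
  proof (rule SL2_unipotent_induct)
    fix A B :: mat2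
    assume A: "\<forall>f\<in>borel_measurable borel. haar (\<lambda>x. f (A ** x)) = haar f"
       and B: "\<forall>f\<in>borel_measurable borel. haar (\<lambda>x. f (B ** x)) = haar f"
    show "\<forall>f\<in>borel_measurable borel. haar (\<lambda>x. f (A ** B ** x)) = haar f"
    proof
      fix f :: "mat2 \<Rightarrow> ennreal" assume [measurable]: "f \<in> borel_measurable borel"
      have "haar (\<lambda>x. f (A ** B ** x)) = haar (\<lambda>x. (\<lambda>y. f (A ** y)) (B ** x))"
        by (simp add: matrix_mul_assoc)
      also have "\<dots> = haar (\<lambda>y. f (A ** y))" by (rule bspec[OF B]) measurable
      also have "\<dots> = haar f" by (rule bspec[OF A]) measurable
      finally show "haar (\<lambda>x. f (A ** B ** x)) = haar f" .
    qed
  qed (simp_all add: haar_left_umat haar_left_hmat)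
  then show ?thesis using assms(2) by blast
qed

section \<open>Fundamental domains and uniqueness of the invariant measure\<close>

definition preim :: "nat \<Rightarrow> mat2 set set \<Rightarrow> mat2 set" where
  "preim q A = {g \<in> SL2. coset q g \<in> A}"

lemma sigma_algebra_Xq:
  "sigma_algebra (Xq q) {A. A \<subseteq> Xq q \<and> {g \<in> SL2. coset q g \<in> A} \<in> sets borel}"
  unfolding sigma_algebra_iff2
proof (intro conjI ballI allI impI)
  fix A assume "A \<in> {A. A \<subseteq> Xq q \<and> {g \<in> SL2. coset q g \<in> A} \<in> sets borel}"
  moreover have "{g \<in> SL2. coset q g \<in> Xq q - A} = SL2 - {g \<in> SL2. coset q g \<in> A}"
    by (auto simp: Xq_def)
  ultimately show "Xq q - A \<in> {A. A \<subseteq> Xq q \<and> {g \<in> SL2. coset q g \<in> A} \<in> sets borel}"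
    using SL2_borel by auto
next
  fix A :: "nat \<Rightarrow> mat2 set set"
  assume A: "range A \<subseteq> {A. A \<subseteq> Xq q \<and> {g \<in> SL2. coset q g \<in> A} \<in> sets borel}"
  have "{g \<in> SL2. coset q g \<in> (\<Union>i. A i)} = (\<Union>i. {g \<in> SL2. coset q g \<in> A i})" by auto
  also have "\<dots> \<in> sets borel" using A by (intro sets.countable_UN) auto
  finally show "(\<Union>i. A i) \<in> {A. A \<subseteq> Xq q \<and> {g \<in> SL2. coset q g \<in> A} \<in> sets borel}"
    using A by auto
qed auto

lemma space_Xq: "space (Xq_space q) = Xq q"
  unfolding Xq_space_def by (rule space_measure_of) auto

lemma sets_Xq: "A \<in> sets (Xq_space q) \<longleftrightarrow> A \<subseteq> Xq q \<and> preim q A \<in> sets borel"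
proof -
  have "sets (Xq_space q) = {A. A \<subseteq> Xq q \<and> {g \<in> SL2. coset q g \<in> A} \<in> sets borel}"
    unfolding Xq_space_def
    by (subst sets_measure_of, blast) (rule sigma_algebra.sigma_sets_eq[OF sigma_algebra_Xq])
  then show ?thesis by (simp add: preim_def)
qed

lemma SL2_left_mult_iff: "g \<in> SL2 \<Longrightarrow> g ** h \<in> SL2 \<longleftrightarrow> h \<in> SL2"
  by (simp add: SL2_def det_mul)

lemma coset_left_mult_iff: "g \<in> SL2 \<Longrightarrow> g ** h \<in> coset q (g ** k) \<longleftrightarrow> h \<in> coset q k"
proof -
  assume g: "g \<in> SL2"
  have "g ** h = g ** k ** \<gamma> \<longleftrightarrow> h = k ** \<gamma>" for \<gamma>
    unfolding matrix_mul_assoc[symmetric] by (metis g minv_cancel(2))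
  then show ?thesis unfolding coset_def by blast
qed

lemma Xq_cases: assumes "x \<in> Xq q" obtains g where "g \<in> SL2" "x = coset q g"
  using assms unfolding Xq_def by blast

lemma lmul_Xq: "g \<in> SL2 \<Longrightarrow> x \<in> Xq q \<Longrightarrow> lmul g x \<in> Xq q"
  by (erule Xq_cases) (auto simp: lmul_coset Xq_def intro: SL2_mult)

lemma lmul_cancel:
  assumes "g \<in> SL2" "x \<in> Xq q"
  shows "lmul g (lmul (minv g) x) = x" "lmul (minv g) (lmul g x) = x"
  using assms(2) by (auto elim!: Xq_cases simp: lmul_coset minv_cancel assms(1))

lemma lmul_image:
  assumes g: "g \<in> SL2" and A: "A \<subseteq> Xq q"
  shows "lmul g ` A = {x \<in> Xq q. lmul (minv g) x \<in> A}"
proof (intro subset_antisym subsetI)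
  fix x assume "x \<in> lmul g ` A"
  then show "x \<in> {x \<in> Xq q. lmul (minv g) x \<in> A}"
    using A lmul_Xq[OF g] lmul_cancel(2)[OF g] by auto
next
  fix x assume "x \<in> {x \<in> Xq q. lmul (minv g) x \<in> A}"
  then show "x \<in> lmul g ` A" using lmul_cancel(1)[OF g, of x] by (metis (mono_tags, lifting) image_eqI mem_Collect_eq)
qed

lemma preim_lmul:
  assumes g: "g \<in> SL2" and A: "A \<subseteq> Xq q"
  shows "preim q (lmul g ` A) = {h. minv g ** h \<in> preim q A}"
  unfolding lmul_image[OF assms] preim_def
  by (auto simp: lmul_coset SL2_left_mult_iff minv_SL2 g Xq_def)

lemma measurable_Collect_mult:
  fixes g :: mat2
  assumes "B \<in> sets borel" shows "{h::mat2. g ** h \<in> B} \<in> sets borel" "{h::mat2. h ** g \<in> B} \<in> sets borel"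
proof -
  have "(\<lambda>h::mat2. g ** h) \<in> borel_measurable borel" "(\<lambda>h::mat2. h ** g) \<in> borel_measurable borel"
    by measurable
  from this[THEN measurable_sets, OF assms]
  have "(\<lambda>h. g ** h) -` B \<inter> space borel \<in> sets borel" "(\<lambda>h. h ** g) -` B \<inter> space borel \<in> sets borel" .
  then show "{h::mat2. g ** h \<in> B} \<in> sets borel" "{h::mat2. h ** g \<in> B} \<in> sets borel"
    by (simp_all add: vimage_def)
qed

lemma sets_lmul_image:
  assumes "g \<in> SL2" "A \<in> sets (Xq_space q)" shows "lmul g ` A \<in> sets (Xq_space q)"
  using assms lmul_Xq[OF assms(1)] measurable_Collect_mult(1)[of "preim q A" "minv g"]
  unfolding sets_Xq by (auto simp: preim_lmul)

lemma measurable_lmul: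
  assumes g: "g \<in> SL2" shows "lmul g \<in> measurable (Xq_space q) (Xq_space q)"
proof (rule measurableI)
  show "lmul g x \<in> space (Xq_space q)" if "x \<in> space (Xq_space q)" for x
    using that lmul_Xq[OF g] by (simp add: space_Xq)
  fix A assume A: "A \<in> sets (Xq_space q)"
  have "lmul g -` A \<inter> space (Xq_space q) = lmul (minv g) ` A"
    using lmul_image[OF minv_SL2[OF g], of A q] A by (auto simp: sets_Xq space_Xq)
  then show "lmul g -` A \<inter> space (Xq_space q) \<in> sets (Xq_space q)"
    using sets_lmul_image[OF minv_SL2[OF g] A] by simp
qed

section \<open>Fundamental domains\<close>

lemma AE_psi_SL2: "AE y in lborel. psi y \<in> SL2"
proof (rule AE_I)
  have "{(0::real)} \<times> (UNIV::real set) \<in> null_sets (lborel \<Otimes>\<^sub>M lborel)"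
    by (intro lborel.times_in_null_sets1) auto
  then have "({(0::real)} \<times> (UNIV::real set)) \<times> (UNIV::real set) \<in> null_sets ((lborel \<Otimes>\<^sub>M lborel) \<Otimes>\<^sub>M lborel)"
    by (intro lborel.times_in_null_sets1) auto
  then have n: "({(0::real)} \<times> (UNIV::real set)) \<times> (UNIV::real set) \<in> null_sets lborel"
    by (simp add: lborel_prod)
  show "emeasure lborel (({(0::real)} \<times> (UNIV::real set)) \<times> (UNIV::real set)) = 0"
    "({(0::real)} \<times> (UNIV::real set)) \<times> (UNIV::real set) \<in> sets lborel"
    using n by auto
  show "{y \<in> space lborel. psi y \<notin> SL2} \<subseteq> ({0} \<times> UNIV) \<times> UNIV"
    by (auto simp: psi_def intro!: SL2_mult SL2_hmat SL2_gmat)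
qed

lemma haar_cong:
  assumes "\<And>g. g \<in> SL2 \<Longrightarrow> f g = f' g" shows "haar f = haar f'"
  unfolding haar_def using AE_psi_SL2 assms by (intro nn_integral_cong_AE) auto

text \<open>Every coset meets the domain exactly once, with no exceptional null set, so that
  \<open>rep\<close> is a section on the whole quotient.\<close>

definition fundom :: "nat \<Rightarrow> mat2 set \<Rightarrow> bool" where
  "fundom q D \<longleftrightarrow> D \<in> sets borel \<and> D \<subseteq> SL2 \<and> (\<forall>g\<in>SL2. \<exists>!h. h \<in> coset q g \<and> h \<in> D)"

lemma fundom_translate:
  assumes g: "g \<in> SL2" and D: "fundom q D" shows "fundom q {h. g ** h \<in> D}"
  unfolding fundom_def
proof (intro conjI ballI)
  show "{h. g ** h \<in> D} \<in> sets borel" using D by (intro measurable_Collect_mult) (simp add: fundom_def)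
  show "{h. g ** h \<in> D} \<subseteq> SL2" using D SL2_left_mult_iff[OF g] by (auto simp: fundom_def)
  fix k assume "k \<in> SL2"
  then have "\<exists>!h. h \<in> coset q (g ** k) \<and> h \<in> D" using D SL2_mult[OF g] by (auto simp: fundom_def)
  then obtain h where h: "h \<in> coset q (g ** k)" "h \<in> D"
    and u: "\<And>h'. h' \<in> coset q (g ** k) \<Longrightarrow> h' \<in> D \<Longrightarrow> h' = h" by blast
  show "\<exists>!h. h \<in> coset q k \<and> h \<in> {h. g ** h \<in> D}"
  proof (rule ex1I[of _ "minv g ** h"])
    show "minv g ** h \<in> coset q k \<and> minv g ** h \<in> {h. g ** h \<in> D}"
      using h coset_left_mult_iff[OF g, of "minv g ** h" q k] by (simp add: minv_cancel g)
    fix h' assume "h' \<in> coset q k \<and> h' \<in> {h. g ** h \<in> D}"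
    then have "g ** h' = h" using u coset_left_mult_iff[OF g] by simp
    then show "h' = minv g ** h" by (auto simp: minv_cancel g)
  qed
qed

text \<open>The translates of the domain form a partition of unity over the group, in the two forms
  needed to fold and unfold integrals.\<close>

lemma fundom_count:
  assumes D: "fundom q D" and g: "g \<in> SL2"
  shows "(\<integral>\<^sup>+\<gamma>. indicator D (g ** \<gamma>) \<partial>count_space (Gq q)) = 1"
    and "(\<integral>\<^sup>+\<gamma>. indicator D (g ** minv \<gamma>) \<partial>count_space (Gq q)) = 1"
proof -
  obtain h where "h \<in> coset q g" "h \<in> D" and u: "\<And>h'. h' \<in> coset q g \<Longrightarrow> h' \<in> D \<Longrightarrow> h' = h"
    using D g unfolding fundom_def by blast
  then obtain \<delta> where \<delta>: "\<delta> \<in> Gq q" "g ** \<delta> \<in> D" "h = g ** \<delta>" unfolding coset_def by blast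
  have un: "\<gamma> = \<delta>" if "\<gamma> \<in> Gq q" "g ** \<gamma> \<in> D" for \<gamma>
  proof -
    have "g ** \<gamma> = g ** \<delta>" using u[of "g ** \<gamma>"] that \<delta>(3) unfolding coset_def by blast
    then show ?thesis by (metis g minv_cancel(2))
  qed
  have "(\<integral>\<^sup>+\<gamma>. indicator D (g ** \<gamma>) \<partial>count_space (Gq q)) = (\<integral>\<^sup>+\<gamma>. indicator {\<delta>} \<gamma> \<partial>count_space (Gq q))"
  proof (rule nn_integral_cong)
    fix \<gamma> assume "\<gamma> \<in> space (count_space (Gq q))"
    then have "g ** \<gamma> \<in> D \<longleftrightarrow> \<gamma> = \<delta>" using un[of \<gamma>] \<delta>(2) by fastforce
    then show "indicator D (g ** \<gamma>) = (indicator {\<delta>} \<gamma> :: ennreal)" by (simp add: indicator_def)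
  qed
  also have "\<dots> = 1" using \<delta> by simp
  finally show "(\<integral>\<^sup>+\<gamma>. indicator D (g ** \<gamma>) \<partial>count_space (Gq q)) = 1" .
  have "(\<integral>\<^sup>+\<gamma>. indicator D (g ** minv \<gamma>) \<partial>count_space (Gq q)) = (\<integral>\<^sup>+\<gamma>. indicator {minv \<delta>} \<gamma> \<partial>count_space (Gq q))"
  proof (rule nn_integral_cong)
    fix \<gamma> assume "\<gamma> \<in> space (count_space (Gq q))"
    then have "\<gamma> \<in> Gq q" by simp
    then have "g ** minv \<gamma> \<in> D \<longleftrightarrow> \<gamma> = minv \<delta>"
      using un[of "minv \<gamma>"] Gq_minv[of \<gamma> q] \<delta> by (metis minv_minv)
    then show "indicator D (g ** minv \<gamma>) = (indicator {minv \<delta>} \<gamma> :: ennreal)"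
      by (simp add: indicator_def)
  qed
  also have "\<dots> = 1" using Gq_minv[OF \<delta>(1)] by simp
  finally show "(\<integral>\<^sup>+\<gamma>. indicator D (g ** minv \<gamma>) \<partial>count_space (Gq q)) = 1" .
qed

lemma preim_mult_Gq: "\<gamma> \<in> Gq q \<Longrightarrow> g \<in> SL2 \<Longrightarrow> g ** \<gamma> \<in> preim q A \<longleftrightarrow> g \<in> preim q A"
  by (auto simp: preim_def coset_mult_Gq SL2_mult Gq_SL2)

lemma haar_count_swap:
  assumes "\<And>\<gamma>. \<gamma> \<in> Gq q \<Longrightarrow> f \<gamma> \<in> borel_measurable borel"
  shows "haar (\<lambda>g. \<integral>\<^sup>+\<gamma>. f \<gamma> g \<partial>count_space (Gq q)) = (\<integral>\<^sup>+\<gamma>. haar (f \<gamma>) \<partial>count_space (Gq q))"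
  unfolding haar_def
  by (rule nn_integral_count_space_nn_integral[OF countable_Gq])
    (use assms in \<open>auto intro: measurable_compose[OF measurable_psi]\<close>)

text \<open>Insert the partition of unity of D', exchange sum and integral, translate the term of
  \<gamma> by its inverse on the right, which preserves \<open>preim q A\<close>, and sum the
  partition of unity of D.\<close>

lemma haar_fundom_eq:
  assumes D: "fundom q D" and D': "fundom q D'" and A: "preim q A \<in> sets borel"
  shows "haar (indicator (preim q A \<inter> D)) = haar (indicator (preim q A \<inter> D'))"
proof -
  let ?P = "preim q A"
  have [measurable]: "?P \<in> sets borel" "D \<in> sets borel" "D' \<in> sets borel"
    using A D D' by (auto simp: fundom_def)
  have "haar (indicator (?P \<inter> D)) = haar (\<lambda>g. \<integral>\<^sup>+\<gamma>. indicator (?P \<inter> D) g * indicator D' (g ** \<gamma>) \<partial>count_space (Gq q))"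
    by (rule haar_cong) (simp add: nn_integral_cmult fundom_count(1)[OF D'])
  also have "\<dots> = (\<integral>\<^sup>+\<gamma>. haar (\<lambda>g. indicator (?P \<inter> D) g * indicator D' (g ** \<gamma>)) \<partial>count_space (Gq q))"
    by (rule haar_count_swap) measurable
  also have "\<dots> = (\<integral>\<^sup>+\<gamma>. haar (\<lambda>g. indicator (?P \<inter> D') g * indicator D (g ** minv \<gamma>)) \<partial>count_space (Gq q))"
  proof (rule nn_integral_cong)
    fix \<gamma> assume "\<gamma> \<in> space (count_space (Gq q))"
    then have \<gamma>: "\<gamma> \<in> Gq q" by simp
    have "haar (\<lambda>g. indicator (?P \<inter> D) g * indicator D' (g ** \<gamma>)) =
       haar (\<lambda>g. indicator (?P \<inter> D) (g ** minv \<gamma>) * indicator D' (g ** minv \<gamma> ** \<gamma>))"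
      by (rule haar_right_invariant[symmetric, OF minv_SL2[OF Gq_SL2[OF \<gamma>]]]) measurable
    also have "\<dots> = haar (\<lambda>g. indicator (?P \<inter> D') g * indicator D (g ** minv \<gamma>))"
      using preim_mult_Gq[OF Gq_minv[OF \<gamma>]] minv_cancel(4)[OF Gq_SL2[OF \<gamma>]]
      by (intro haar_cong) (auto split: split_indicator)
    finally show "haar (\<lambda>g. indicator (?P \<inter> D) g * indicator D' (g ** \<gamma>)) =
        haar (\<lambda>g. indicator (?P \<inter> D') g * indicator D (g ** minv \<gamma>))" .
  qed
  also have "\<dots> = haar (\<lambda>g. \<integral>\<^sup>+\<gamma>. indicator (?P \<inter> D') g * indicator D (g ** minv \<gamma>) \<partial>count_space (Gq q))"
    by (rule haar_count_swap[symmetric]) measurable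
  also have "\<dots> = haar (indicator (?P \<inter> D'))"
    by (rule haar_cong) (simp add: nn_integral_cmult fundom_count(2)[OF D])
  finally show ?thesis .
qed

section \<open>A Borel section and uniqueness of the invariant measure\<close>

definition rep :: "mat2 set \<Rightarrow> mat2 set \<Rightarrow> mat2" where
  "rep D x = (THE h. h \<in> x \<and> h \<in> D)"

lemma rep_eqI:
  assumes "fundom q D" "x \<in> Xq q" "h \<in> x" "h \<in> D" shows "rep D x = h"
proof -
  obtain g where "g \<in> SL2" "x = coset q g" using assms(2) by (rule Xq_cases)
  then have "\<exists>!h. h \<in> x \<and> h \<in> D" using assms(1) by (auto simp: fundom_def)
  then show ?thesis unfolding rep_def using assms by (intro the1_equality) auto
qed

lemma rep_props:
  assumes "fundom q D" "x \<in> Xq q" shows "rep D x \<in> x" "rep D x \<in> D" "rep D x \<in> SL2" "coset q (rep D x) = x"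
proof -
  obtain g where g: "g \<in> SL2" "x = coset q g" using assms(2) by (rule Xq_cases)
  then have "\<exists>!h. h \<in> x \<and> h \<in> D" using assms(1) by (auto simp: fundom_def)
  then obtain h where "h \<in> x" "h \<in> D" by blast
  then show "rep D x \<in> x" "rep D x \<in> D" using rep_eqI[OF assms] by auto
  then show "rep D x \<in> SL2" "coset q (rep D x) = x" using assms(1) g coset_eqI by (auto simp: fundom_def)
qed

lemma measurable_rep:
  assumes D: "fundom q D" shows "rep D \<in> borel_measurable (Xq_space q)"
proof (rule measurableI)
  fix B :: "mat2 set" assume B: "B \<in> sets borel"
  have "preim q (rep D -` B \<inter> Xq q) = (\<Union>\<gamma>\<in>Gq q. {g. g ** \<gamma> \<in> D \<inter> B}) \<inter> SL2"
  proof (intro set_eqI iffI)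
    fix g assume "g \<in> preim q (rep D -` B \<inter> Xq q)"
    then have g: "g \<in> SL2" "coset q g \<in> Xq q" "rep D (coset q g) \<in> B" by (auto simp: preim_def)
    from rep_props(1,2)[OF D g(2)] obtain \<gamma> where "\<gamma> \<in> Gq q" "rep D (coset q g) = g ** \<gamma>" "g ** \<gamma> \<in> D"
      unfolding coset_def by fastforce
    then show "g \<in> (\<Union>\<gamma>\<in>Gq q. {g. g ** \<gamma> \<in> D \<inter> B}) \<inter> SL2" using g by auto
  next
    fix g assume "g \<in> (\<Union>\<gamma>\<in>Gq q. {g. g ** \<gamma> \<in> D \<inter> B}) \<inter> SL2"
    then obtain \<gamma> where g: "g \<in> SL2" "\<gamma> \<in> Gq q" "g ** \<gamma> \<in> D" "g ** \<gamma> \<in> B" by auto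
    then have "rep D (coset q g) = g ** \<gamma>" by (intro rep_eqI[OF D]) (auto simp: Xq_def coset_def)
    then show "g \<in> preim q (rep D -` B \<inter> Xq q)" using g by (auto simp: preim_def Xq_def)
  qed
  also have "\<dots> \<in> sets borel"
    using D B by (intro sets.Int sets.countable_UN'' countable_Gq measurable_Collect_mult SL2_borel) (auto simp: fundom_def)
  finally show "rep D -` B \<inter> space (Xq_space q) \<in> sets (Xq_space q)"
    unfolding sets_Xq space_Xq by simp
qed simp

text \<open>Integrate \<open>indicator A x * indicator D (g ** rep D x)\<close> over x and g in both
  orders. Right invariance in g gives the left side. Replacing x by its translate under the inverse
  of g, followed by left invariance in g, gives the right side, which does not mention
  \<mu>.\<close>

lemma invariant_measure_eq:
  assumes D: "fundom q D" and sets: "sets \<mu> = sets (Xq_space q)" and prob: "prob_space \<mu>"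
    and inv: "\<And>g A. g \<in> SL2 \<Longrightarrow> A \<in> sets \<mu> \<Longrightarrow> emeasure \<mu> (lmul g ` A) = emeasure \<mu> A"
    and A: "A \<in> sets \<mu>"
  shows "emeasure \<mu> A * haar (indicator D) = haar (\<lambda>y. indicator (preim q A \<inter> D) (minv y))"
proof -
  interpret prob_space \<mu> by fact
  interpret pair_sigma_finite \<mu> "lborel :: ((real \<times> real) \<times> real) measure" ..
  have space: "space \<mu> = Xq q" using sets_eq_imp_space_eq[OF sets] by (simp add: space_Xq)
  have [measurable]: "D \<in> sets borel" "preim q A \<in> sets borel" "A \<in> sets \<mu>"
    using D A sets by (auto simp: fundom_def sets_Xq)
  have [measurable]: "rep D \<in> borel_measurable \<mu>"
    using measurable_rep[OF D] measurable_cong_sets[OF sets refl] by blast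
  have lm: "lmul g \<in> measurable \<mu> \<mu>" if "g \<in> SL2" for g
    using measurable_lmul[OF that] measurable_cong_sets[OF sets sets] by blast
  have di: "distr \<mu> \<mu> (lmul g) = \<mu>" if g: "g \<in> SL2" for g
  proof (rule measure_eqI)
    fix B assume "B \<in> sets (distr \<mu> \<mu> (lmul g))"
    then have B: "B \<in> sets \<mu>" by simp
    then have "B \<subseteq> Xq q" using sets.sets_into_space space by blast
    then have "lmul g -` B \<inter> space \<mu> = lmul (minv g) ` B"
      using lmul_image[OF minv_SL2[OF g], of B q] by (auto simp: space)
    then show "emeasure (distr \<mu> \<mu> (lmul g)) B = emeasure \<mu> B"
      using inv[OF minv_SL2[OF g] B] by (simp add: emeasure_distr[OF lm[OF g] B])
  qed simp
  have "emeasure \<mu> A * haar (indicator D) = (\<integral>\<^sup>+x. indicator A x * haar (indicator D) \<partial>\<mu>)"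
    by (subst nn_integral_multc) auto
  also have "\<dots> = (\<integral>\<^sup>+x. \<integral>\<^sup>+y. indicator A x * indicator D (psi y ** rep D x) \<partial>lborel \<partial>\<mu>)"
  proof (rule nn_integral_cong)
    fix x assume "x \<in> space \<mu>"
    then have "rep D x \<in> SL2" using rep_props(3)[OF D] space by simp
    then have "haar (\<lambda>g. indicator D (g ** rep D x)) = haar (indicator D)"
      by (rule haar_right_invariant) measurable
    then have "haar (indicator D) = (\<integral>\<^sup>+y. indicator D (psi y ** rep D x) \<partial>lborel)"
      by (simp add: haar_def[of "\<lambda>g. indicator D (g ** rep D x)"])
    then show "indicator A x * haar (indicator D) = (\<integral>\<^sup>+y. indicator A x * indicator D (psi y ** rep D x) \<partial>lborel)"
      by (simp add: nn_integral_cmult)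
  qed
  also have "\<dots> = (\<integral>\<^sup>+y. \<integral>\<^sup>+x. indicator A x * indicator D (psi y ** rep D x) \<partial>\<mu> \<partial>lborel)"
    by (rule Fubini'[symmetric]) measurable
  also have "\<dots> = (\<integral>\<^sup>+y. \<integral>\<^sup>+x. indicator (preim q A \<inter> D) (minv (psi y) ** rep D x) \<partial>\<mu> \<partial>lborel)"
  proof (rule nn_integral_cong_AE)
    have "(\<integral>\<^sup>+x. indicator A x * indicator D (g ** rep D x) \<partial>\<mu>) =
       (\<integral>\<^sup>+x. indicator (preim q A \<inter> D) (minv g ** rep D x) \<partial>\<mu>)" if g: "g \<in> SL2" for g
    proof -
      note mg = minv_SL2[OF g]
      have "(\<integral>\<^sup>+x. indicator A x * indicator D (g ** rep D x) \<partial>\<mu>) =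
        (\<integral>\<^sup>+x. indicator A x * indicator D (g ** rep D x) \<partial>distr \<mu> \<mu> (lmul (minv g)))"
        using di[OF mg] by simp
      also have "\<dots> = (\<integral>\<^sup>+x. indicator A (lmul (minv g) x) * indicator D (g ** rep D (lmul (minv g) x)) \<partial>\<mu>)"
        using lm[OF mg] by (subst nn_integral_distr) auto
      also have "\<dots> = (\<integral>\<^sup>+x. indicator (preim q A \<inter> D) (minv g ** rep D x) \<partial>\<mu>)"
      proof (rule nn_integral_cong)
        fix x assume "x \<in> space \<mu>"
        then have x: "x \<in> Xq q" using space by simp
        note r = rep_props[OF D x]
        have gx: "lmul (minv g) x \<in> Xq q" by (rule lmul_Xq[OF mg x])
        note r' = rep_props[OF D gx]
        have cx: "coset q (minv g ** rep D x) = lmul (minv g) x"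
          unfolding lmul_coset[symmetric] r(4) ..
        have cy: "coset q (g ** rep D (lmul (minv g) x)) = x"
          unfolding lmul_coset[symmetric] r'(4) by (rule lmul_cancel(1)[OF g x])
        \<comment> \<open>The first point lies in the coset \<open>x\<close>, the second in
          \<open>lmul (minv g) x\<close>. By strictness of the domain, either membership says that
          \<open>rep D (lmul (minv g) x)\<close> is \<open>minv g ** rep D x\<close>.\<close>
        have "g ** rep D (lmul (minv g) x) \<in> D \<longleftrightarrow> minv g ** rep D x \<in> D"
        proof
          assume "g ** rep D (lmul (minv g) x) \<in> D"
          then have "rep D x = g ** rep D (lmul (minv g) x)"
            using coset_self[of "g ** rep D (lmul (minv g) x)" q] by (intro rep_eqI[OF D x]) (auto simp: cy)
          then show "minv g ** rep D x \<in> D" using r'(2) by (simp add: minv_cancel g)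
        next
          assume "minv g ** rep D x \<in> D"
          then have "rep D (lmul (minv g) x) = minv g ** rep D x"
            using coset_self[of "minv g ** rep D x" q] by (intro rep_eqI[OF D gx]) (auto simp: cx)
          then show "g ** rep D (lmul (minv g) x) \<in> D" using r(2) by (simp add: minv_cancel g)
        qed
        moreover have "minv g ** rep D x \<in> preim q A \<longleftrightarrow> lmul (minv g) x \<in> A"
          using SL2_mult[OF mg r(3)] by (simp add: preim_def cx)
        ultimately show "indicator A (lmul (minv g) x) * indicator D (g ** rep D (lmul (minv g) x)) =
           (indicator (preim q A \<inter> D) (minv g ** rep D x) :: ennreal)"
          by (simp split: split_indicator)
      qed
      finally show ?thesis .
    qed
    then show "AE y in lborel. (\<integral>\<^sup>+x. indicator A x * indicator D (psi y ** rep D x) \<partial>\<mu>) =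
       (\<integral>\<^sup>+x. indicator (preim q A \<inter> D) (minv (psi y) ** rep D x) \<partial>\<mu>)"
      using AE_psi_SL2 by (auto elim!: eventually_mono)
  qed
  also have "\<dots> = (\<integral>\<^sup>+x. \<integral>\<^sup>+y. indicator (preim q A \<inter> D) (minv (psi y) ** rep D x) \<partial>lborel \<partial>\<mu>)"
    by (rule Fubini') measurable
  also have "\<dots> = (\<integral>\<^sup>+x. haar (\<lambda>y. indicator (preim q A \<inter> D) (minv y)) \<partial>\<mu>)"
  proof (rule nn_integral_cong)
    fix x assume "x \<in> space \<mu>"
    then have r: "rep D x \<in> SL2" using rep_props(3)[OF D] space by simp
    have "haar (\<lambda>g. indicator (preim q A \<inter> D) (minv (minv (rep D x) ** g))) =
        haar (\<lambda>y. indicator (preim q A \<inter> D) (minv y))"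
      by (rule haar_left_invariant[OF minv_SL2[OF r]]) measurable
    then show "(\<integral>\<^sup>+y. indicator (preim q A \<inter> D) (minv (psi y) ** rep D x) \<partial>lborel) =
        haar (\<lambda>y. indicator (preim q A \<inter> D) (minv y))"
      by (simp add: minv_mult haar_def)
  qed
  also have "\<dots> = haar (\<lambda>y. indicator (preim q A \<inter> D) (minv y))"
    by (simp add: emeasure_space_1)
  finally show ?thesis .
qed

lemma invariant_measure_unique:
  assumes D: "fundom q D" "haar (indicator D) \<noteq> 0" "haar (indicator D) \<noteq> \<infinity>"
    and \<mu>: "sets \<mu> = sets (Xq_space q)" "prob_space \<mu>"
      "\<forall>g\<in>SL2. \<forall>A\<in>sets \<mu>. emeasure \<mu> (lmul g ` A) = emeasure \<mu> A"
    and \<nu>: "sets \<nu> = sets (Xq_space q)" "prob_space \<nu>"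
      "\<forall>g\<in>SL2. \<forall>A\<in>sets \<nu>. emeasure \<nu> (lmul g ` A) = emeasure \<nu> A"
  shows "\<mu> = \<nu>"
proof (rule measure_eqI)
  fix A assume A: "A \<in> sets \<mu>"
  have "emeasure \<mu> A * haar (indicator D) = emeasure \<nu> A * haar (indicator D)"
    using invariant_measure_eq[OF D(1) \<mu>(1,2), of A] invariant_measure_eq[OF D(1) \<nu>(1,2), of A] A \<mu> \<nu>
    by simp
  then show "emeasure \<mu> A = emeasure \<nu> A"
    using D(2,3) by (simp add: mult.commute[of _ "haar _"] ennreal_mult_cancel_left)
qed (use \<mu> \<nu> in simp)

section \<open>The roof function\<close>

lemma measurable_fst_borel [measurable]: "fst \<in> borel_measurable (borel :: ('a::second_countable_topology \<times> 'b::second_countable_topology) measure)"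
  and measurable_snd_borel [measurable]: "snd \<in> borel_measurable (borel :: ('a \<times> 'b) measure)"
  unfolding borel_prod[symmetric] by simp_all

lemma measurable_Pair_borel:
  fixes f :: "'c \<Rightarrow> 'a::second_countable_topology" and g :: "'c \<Rightarrow> 'b::second_countable_topology"
  assumes "f \<in> borel_measurable M" "g \<in> borel_measurable M"
  shows "(\<lambda>x. (f x, g x)) \<in> borel_measurable M"
  using measurable_Pair[OF assms] by (simp add: borel_prod)

lemma measurable_gp: "gp \<in> borel_measurable borel"
  unfolding gmat_def
  by (intro measurable_mat2 borel_measurable_divide measurable_fst_borel measurable_snd_borel borel_measurable_const)

text \<open>Stated for a single group element, so that the sublevel sets of the roof become
  countable unions of Borel sets.\<close>

definition pos_slope :: "mat2 \<Rightarrow> real \<times> real \<Rightarrow> real \<Rightarrow> bool" where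
  "pos_slope \<gamma> p r \<longleftrightarrow> 0 < (gp p ** \<gamma>)$1$1 \<and> (gp p ** \<gamma>)$1$1 \<le> 1 \<and>
     0 < (gp p ** \<gamma>)$2$1 / (gp p ** \<gamma>)$1$1 \<and> (gp p ** \<gamma>)$2$1 / (gp p ** \<gamma>)$1$1 \<le> r"

lemma pos_slope_iff: "(\<exists>\<gamma>\<in>Gq q. pos_slope \<gamma> p r) \<longleftrightarrow> (\<exists>t\<in>slopes q (gp p). 0 < t \<and> t \<le> r)"
  unfolding pos_slope_def Bex_def slopes_iff coset_def by blast

lemma measurable_pos_slope:
  assumes "f \<in> borel_measurable M" "g \<in> borel_measurable M"
  shows "{x \<in> space M. pos_slope \<gamma> (f x) (g x)} \<in> sets M"
proof -
  have [measurable]: "(\<lambda>x. (gp (f x) ** \<gamma>) $ i $ j) \<in> borel_measurable M" for i j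
    by (intro measurable_compose[OF _ measurable_entry] measurable_mat2_mult measurable_compose[OF assms(1) measurable_gp]) simp
  have [measurable]: "g \<in> borel_measurable M" by fact
  show ?thesis unfolding pos_slope_def by measurable
qed

context
  fixes q :: nat
  assumes q3: "q \<ge> 3"
begin

text \<open>Since \<open>1 / 0 = 0\<close>, the second row of \<open>gmat 0 b\<close> vanishes. A
  point with a positive slope therefore has nonzero first coordinate, and separation of slopes
  applies to it.\<close>

lemma slopes_degenerate: "t \<in> slopes q (gmat 0 b) \<Longrightarrow> t = 0"
  by (auto simp: slopes_iff coset_def mult_nth gmat_def)

text \<open>Integrability needs \<open>Rq\<close> to be Borel on the whole plane: off the triangle there may be no
  positive slope, and then \<open>Rq\<close> is the constant \<open>LEAST t. False\<close>.\<close>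

lemma Rq_le_iff:
  "Rq q p \<le> r \<longleftrightarrow> (\<exists>\<gamma>\<in>Gq q. pos_slope \<gamma> p r) \<or>
     (\<not> (\<exists>t\<in>slopes q (gp p). 0 < t)) \<and> (LEAST t::real. False) \<le> r"
proof (cases "\<exists>t\<in>slopes q (gp p). 0 < t")
  case True
  then have "fst p \<noteq> 0" using slopes_degenerate by (metis less_irrefl)
  then have g: "gp p \<in> SL2" by (rule SL2_gmat)
  let ?A = "{r \<in> slopes q (gp p). 0 < r}"
  have "\<exists>m\<in>?A. \<forall>x\<in>?A. m \<le> x"
    using True slopes_separated[OF q3 g] by (intro separated_has_min[of _ 0]) auto
  then obtain m where m: "m \<in> slopes q (gp p)" "0 < m" "\<And>x. x \<in> slopes q (gp p) \<Longrightarrow> 0 < x \<Longrightarrow> m \<le> x"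
    by blast
  have R: "Rq q p = m" unfolding Rq_Least using m by (intro Least_equality) auto
  show ?thesis unfolding pos_slope_iff R using m True by (meson order.trans)
next
  case False
  then have *: "(\<lambda>t. t \<in> slopes q (gp p) \<and> 0 < t) = (\<lambda>t. False)" by auto
  show ?thesis unfolding Rq_Least * pos_slope_iff using False by auto
qed

lemma ex_pos_slope_iff: "(\<exists>t\<in>slopes q (gp p). 0 < t) \<longleftrightarrow> (\<exists>n::nat. \<exists>\<gamma>\<in>Gq q. pos_slope \<gamma> p (real n))"
  unfolding pos_slope_iff using real_arch_simple by blast

lemma measurable_Rq [measurable]: "Rq q \<in> borel_measurable borel"
proof (rule borel_measurableI_le)
  fix r
  have 1: "{p \<in> space borel. \<exists>\<gamma>\<in>Gq q. pos_slope \<gamma> p r} \<in> sets borel" for r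
  proof -
    have "{p \<in> space borel. \<exists>\<gamma>\<in>Gq q. pos_slope \<gamma> p r} = (\<Union>\<gamma>\<in>Gq q. {p \<in> space borel. pos_slope \<gamma> p r})" by auto
    also have "\<dots> \<in> sets borel"
      by (intro sets.countable_UN'' countable_Gq measurable_pos_slope) auto
    finally show ?thesis .
  qed
  have "{p \<in> space borel. \<exists>n::nat. \<exists>\<gamma>\<in>Gq q. pos_slope \<gamma> p (real n)} \<in> sets borel"
    by (intro sets.sets_Collect_countable_Ex 1)
  then show "{p \<in> space borel. Rq q p \<le> r} \<in> sets borel"
    unfolding Rq_le_iff ex_pos_slope_iff
    by (intro sets.sets_Collect_disj sets.sets_Collect_conj sets.sets_Collect_neg 1) auto
qed

lemma triangle_borel [measurable]: "BCZ_triangle q \<in> sets borel"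
proof -
  have "BCZ_triangle q = {p \<in> space borel. 0 < fst p \<and> fst p \<le> 1 \<and> 1 - lambda_q q * fst p < snd p \<and> snd p \<le> 1}"
    by (auto simp: BCZ_triangle_def)
  also have "\<dots> \<in> sets borel" by measurable
  finally show ?thesis .
qed

lemma Yq_borel [measurable]: "Yq q \<in> sets borel"
proof -
  have [measurable]: "(\<lambda>y. Rq q (fst y)) \<in> borel_measurable (borel :: ((real \<times> real) \<times> real) measure)"
    by (rule measurable_compose[OF measurable_fst_borel measurable_Rq])
  have [measurable]: "{y \<in> space borel. fst y \<in> BCZ_triangle q} \<in> sets (borel :: ((real \<times> real) \<times> real) measure)"
    using measurable_sets[OF measurable_fst_borel triangle_borel] by (simp add: vimage_def)
  have "Yq q = {y \<in> space borel. fst y \<in> BCZ_triangle q} \<inter> {y \<in> space borel. 0 \<le> snd y \<and> snd y < Rq q (fst y)}"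
    by (auto simp: Yq_def)
  also have "\<dots> \<in> sets borel" by measurable
  finally show ?thesis .
qed

text \<open>The roof is at most the slope of the vector found in \<open>first_short_vector\<close>,
  whose first coordinate is \<beta>. For k \<le> q - 2 the determinant identity bounds \<beta> away
  from 0, and C collects these finitely many bounds. For k = q - 1 it is only b, and 1 / (a b) is
  split into 3 / a + 3 / b; in that case (b, a) lies in the triangle too, which will make 3 / b
  integrable.\<close>

lemma Rq_bound:
  defines "C \<equiv> \<Sum>k\<in>{2..q - 2}. usin q k * usin q (k - 1) / (usin q k - 1)"
  assumes p: "(a, b) \<in> BCZ_triangle q"
  shows "0 \<le> C" "Rq q (a, b) \<le> (C + 3) / a + 3 / b * indicator (BCZ_triangle q) (b, a)"
proof -
  have u: "1 \<le> usin q k" "1 \<le> usin q (k - 1)" "1 < usin q k" if "k \<in> {2..q - 2}" for k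
    using that usin_ge_1[OF q3, of k] usin_ge_1[OF q3, of "k - 1"] usin_gt_1[OF q3, of k] by auto
  have nn: "0 \<le> usin q k * usin q (k - 1) / (usin q k - 1)" if "k \<in> {2..q - 2}" for k
    using u[OF that] by simp
  then show C0: "0 \<le> C" unfolding C_def by (rule sum_nonneg)
  have a: "0 < a" "a \<le> 1" "1 < lambda_q q * a + b" "b \<le> 1" using p by (auto simp: BCZ_triangle_def)
  have i0: "0 \<le> 3 / b * indicator (BCZ_triangle q) (b, a)" by (auto simp: BCZ_triangle_def indicator_def)
  obtain k where k: "2 \<le> k" "k \<le> q - 1" "1 < a * usin q k + b * usin q (k - 1)"
     "0 < a * usin q (k + 1) + b * usin q k" "a * usin q (k + 1) + b * usin q k \<le> 1"
    using first_short_vector[OF q3 p] by blast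
  define \<beta> where "\<beta> = a * usin q (k + 1) + b * usin q k"
  have uk: "1 \<le> usin q k" using usin_ge_1[OF q3, of k] k q3 by force
  have R: "Rq q (a, b) \<le> usin q k / (a * \<beta>)"
    using usin_slope[OF q3 a(1) k(4,5)] uk k(4) a(1) by (intro Rq_props(3)[OF q3 p]) (auto simp: \<beta>_def)
  show "Rq q (a, b) \<le> (C + 3) / a + 3 / b * indicator (BCZ_triangle q) (b, a)"
  proof (cases "k = q - 1")
    case True
    have e: "k + 1 = q" "k - 1 = q - 2" using True q3 by auto
    have \<beta>: "\<beta> = b" unfolding \<beta>_def e(1) using True usin_q[OF q3] usin_q_minus_1[OF q3] by simp
    have b: "0 < b" "1 < a + b * lambda_q q"
      using k(3,4) \<beta> True usin_q_minus_1[OF q3] usin_q_minus_2[OF q3] unfolding \<beta>_def e by auto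
    have "(b, a) \<in> BCZ_triangle q" using a b by (auto simp: BCZ_triangle_def mult.commute)
    moreover have "1 / (a * b) \<le> 3 / a + 3 / b"
    proof -
      have "lambda_q q * a \<le> 2 * a" "b * lambda_q q \<le> 2 * b" using lambda_less_2[OF q3] a b by auto
      \<comment> \<open>Add 1 < 2 a + b and 1 < a + 2 b.\<close>
      then have "1 \<le> 3 * (a + b)" using a(3) b(2) by simp
      then have "1 / (a * b) \<le> 3 * (a + b) / (a * b)" using a b by (intro divide_right_mono) auto
      also have "\<dots> = 3 / a + 3 / b" using a b by (simp add: field_simps)
      finally show ?thesis .
    qed
    moreover have "3 / a \<le> (C + 3) / a" using C0 a by (intro divide_right_mono) auto
    moreover have "usin q k = 1" using True usin_q_minus_1[OF q3] by simp
    ultimately show ?thesis using R \<beta> by simp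
  next
    case False
    then have kk: "k \<in> {2..q - 2}" using k by auto
    note u = u[OF kk]
    obtain j where j: "k = Suc j" using k by (cases k) auto
    have "usin q k * (a * usin q k + b * usin q (k - 1)) - usin q (k - 1) * \<beta> =
      a * (usin q (j + 1) * usin q (j + 1) - usin q j * usin q (j + 2))"
      by (simp add: \<beta>_def j algebra_simps)
    then have "a = usin q k * (a * usin q k + b * usin q (k - 1)) - usin q (k - 1) * \<beta>"
      by (simp only: usin_det[OF q3])
    moreover have "usin q k * 1 \<le> usin q k * (a * usin q k + b * usin q (k - 1))"
      using u k(3) by (intro mult_left_mono) auto
    \<comment> \<open>The first coordinate of the preceding vector exceeds 1, while a \<le>
      1.\<close>
    ultimately have "usin q k - 1 \<le> usin q (k - 1) * \<beta>" using a(2) by linarith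
    then have "usin q k * (usin q k - 1) \<le> usin q k * (usin q (k - 1) * \<beta>)" using u by (intro mult_left_mono) auto
    then have "usin q k / \<beta> \<le> usin q k * usin q (k - 1) / (usin q k - 1)"
      using u k(4)[folded \<beta>_def] by (simp add: divide_le_eq le_divide_eq mult.assoc)
    also have "\<dots> \<le> C" unfolding C_def using nn by (intro member_le_sum kk) auto
    finally have "usin q k / \<beta> / a \<le> (C + 3) / a" using a by (intro divide_right_mono) auto
    then show ?thesis using R i0 by (simp add: mult.commute)
  qed
qed

text \<open>The fibre of the triangle over a has length \<open>lambda_q q\<close> times a, which
  cancels the singularity of K / a.\<close>

lemma triangle_weight:
  assumes K: "0 \<le> K"
  shows "(\<integral>\<^sup>+a. \<integral>\<^sup>+b. ennreal (K / a) * indicator (BCZ_triangle q) (a, b) \<partial>lborel \<partial>lborel) < \<infinity>"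
proof -
  have "(\<integral>\<^sup>+a. \<integral>\<^sup>+b. ennreal (K / a) * indicator (BCZ_triangle q) (a, b) \<partial>lborel \<partial>lborel)
     \<le> (\<integral>\<^sup>+a. ennreal (K * lambda_q q) * indicator {0..1::real} a \<partial>lborel)"
  proof (rule nn_integral_mono)
    fix a :: real
    show "(\<integral>\<^sup>+b. ennreal (K / a) * indicator (BCZ_triangle q) (a, b) \<partial>lborel) \<le> ennreal (K * lambda_q q) * indicator {0..1} a"
    proof (cases "0 < a \<and> a \<le> 1")
      case True
      have l: "0 \<le> lambda_q q" using lambda_ge_1[OF q3] by simp
      have "(\<integral>\<^sup>+b. ennreal (K / a) * indicator (BCZ_triangle q) (a, b) \<partial>lborel) =
        (\<integral>\<^sup>+b. ennreal (K / a) * indicator {1 - lambda_q q * a<..1} b \<partial>lborel)"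
        using True by (intro nn_integral_cong) (auto simp: BCZ_triangle_def indicator_def)
      also have "\<dots> = ennreal (K / a) * ennreal (lambda_q q * a)"
        using True l by (simp add: nn_integral_cmult_indicator)
      also have "\<dots> = ennreal (K * lambda_q q)"
        using True l K by (simp add: ennreal_mult[symmetric])
      finally show ?thesis using True by simp
    next
      case False
      then have "(\<lambda>b. ennreal (K / a) * indicator (BCZ_triangle q) (a, b)) = (\<lambda>b. 0)"
        by (auto simp: BCZ_triangle_def indicator_def)
      then show ?thesis by simp
    qed
  qed
  also have "\<dots> < \<infinity>" by (simp add: nn_integral_cmult_indicator ennreal_mult_less_top)
  finally show ?thesis .
qed

lemma Rq_nn_integral_finite: "(\<integral>\<^sup>+p. ennreal (Rq q p) * indicator (BCZ_triangle q) p \<partial>lborel) < \<infinity>"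
proof -
  let ?T = "BCZ_triangle q"
  have [measurable]: "(\<lambda>(a, b). (indicator ?T (a, b) :: ennreal)) \<in> borel_measurable (borel \<Otimes>\<^sub>M borel)"
    "(\<lambda>(b, a). (indicator ?T (a, b) :: ennreal)) \<in> borel_measurable (borel \<Otimes>\<^sub>M borel)"
  proof -
    have T: "(indicator ?T :: _ \<Rightarrow> ennreal) \<in> borel_measurable (borel \<Otimes>\<^sub>M borel)"
      by (simp add: borel_prod)
    then show "(\<lambda>(a, b). (indicator ?T (a, b) :: ennreal)) \<in> borel_measurable (borel \<Otimes>\<^sub>M borel)" by simp
    show "(\<lambda>(b, a). (indicator ?T (a, b) :: ennreal)) \<in> borel_measurable (borel \<Otimes>\<^sub>M borel)"
      using measurable_pair_swap[OF T] by simp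
  qed
  define K where "K = (\<Sum>k\<in>{2..q - 2}. usin q k * usin q (k - 1) / (usin q k - 1)) + 3"
  have "(1, 1) \<in> ?T" using lambda_ge_1[OF q3] by (simp add: BCZ_triangle_def)
  then have K: "0 \<le> K" using Rq_bound(1) unfolding K_def by force
  have bd: "ennreal (Rq q (a, b)) * indicator ?T (a, b) \<le>
      ennreal (K / a) * indicator ?T (a, b) + ennreal (3 / b) * indicator ?T (b, a)" for a b
  proof (cases "(a, b) \<in> ?T")
    case True
    have a: "0 < a" using True by (simp add: BCZ_triangle_def)
    have "ennreal (Rq q (a, b)) \<le> ennreal (K / a + 3 / b * indicator ?T (b, a))"
      using Rq_bound(2)[OF True] by (intro ennreal_leI) (simp add: K_def)
    also have "\<dots> = ennreal (K / a) + ennreal (3 / b * indicator ?T (b, a))"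
      using K a by (intro ennreal_plus) (auto simp: BCZ_triangle_def indicator_def)
    finally show ?thesis using True by (auto simp: indicator_def)
  qed simp
  have "(\<integral>\<^sup>+p. ennreal (Rq q p) * indicator ?T p \<partial>lborel) =
     (\<integral>\<^sup>+a. \<integral>\<^sup>+b. ennreal (Rq q (a, b)) * indicator ?T (a, b) \<partial>lborel \<partial>lborel)"
    by (rule nn_integral_lborel_pair) measurable
  also have "\<dots> \<le> (\<integral>\<^sup>+a. \<integral>\<^sup>+b. ennreal (K / a) * indicator ?T (a, b) + ennreal (3 / b) * indicator ?T (b, a) \<partial>lborel \<partial>lborel)"
    by (intro nn_integral_mono bd)
  also have "\<dots> = (\<integral>\<^sup>+a. \<integral>\<^sup>+b. ennreal (K / a) * indicator ?T (a, b) \<partial>lborel \<partial>lborel) +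
      (\<integral>\<^sup>+a. \<integral>\<^sup>+b. ennreal (3 / b) * indicator ?T (b, a) \<partial>lborel \<partial>lborel)"
  proof -
    have "(\<lambda>b. indicator ?T (a, b) :: ennreal) \<in> borel_measurable borel" "(\<lambda>b. indicator ?T (b, a) :: ennreal) \<in> borel_measurable borel" for a
      by measurable
    then show ?thesis
      by (subst nn_integral_add[symmetric]) (auto intro!: nn_integral_cong nn_integral_add)
  qed
  \<comment> \<open>With the order of integration exchanged, the reflected term is an instance of
    \<open>triangle_weight\<close>.\<close>
  also have "(\<integral>\<^sup>+a. \<integral>\<^sup>+b. ennreal (3 / b) * indicator ?T (b, a) \<partial>lborel \<partial>lborel) =
     (\<integral>\<^sup>+b. \<integral>\<^sup>+a. ennreal (3 / b) * indicator ?T (b, a) \<partial>lborel \<partial>lborel)"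
    by (rule nn_integral_lborel_swap) measurable
  finally show ?thesis
    using triangle_weight[OF K] triangle_weight[of 3] by (auto intro: le_less_trans)
qed

text \<open>The roof is at least 1 on the triangle, which contains an open square because
  \<open>lambda_q q\<close> is at least 1.\<close>

lemma Rq_nn_integral_pos: "(\<integral>\<^sup>+p. ennreal (Rq q p) * indicator (BCZ_triangle q) p \<partial>lborel) \<noteq> 0"
proof
  let ?B = "{1/2<..<1} \<times> {1/2<..<1} :: (real \<times> real) set"
  assume z: "(\<integral>\<^sup>+p. ennreal (Rq q p) * indicator (BCZ_triangle q) p \<partial>lborel) = 0"
  have "emeasure lborel ?B = emeasure lborel {1/2<..<1::real} * emeasure lborel {1/2<..<1::real}"
    unfolding lborel_prod[symmetric] by (rule lborel.emeasure_pair_measure_Times) auto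
  also have "\<dots> \<noteq> 0" by simp
  finally have "emeasure lborel ?B \<noteq> 0" .
  moreover have "emeasure lborel ?B \<le> (\<integral>\<^sup>+p. ennreal (Rq q p) * indicator (BCZ_triangle q) p \<partial>lborel)"
  proof -
    have "p \<in> BCZ_triangle q" if "p \<in> ?B" for p
    proof -
      have B: "1 / 2 < fst p" "fst p < 1" "1 / 2 < snd p" "snd p < 1" using that by auto
      have "1 * fst p \<le> lambda_q q * fst p" using lambda_ge_1[OF q3] B by (intro mult_right_mono) auto
      then have "1 - lambda_q q * fst p < snd p" using B by linarith
      then show ?thesis using B by (cases p) (simp add: BCZ_triangle_def)
    qed
    moreover have "1 \<le> ennreal (Rq q p)" if "p \<in> BCZ_triangle q" for p
      using Rq_props(2)[OF q3 that] by simp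
    ultimately have "indicator ?B p \<le> ennreal (Rq q p) * indicator (BCZ_triangle q) p" for p
      by (auto simp: indicator_def)
    then have "(\<integral>\<^sup>+p. indicator ?B p \<partial>lborel) \<le> (\<integral>\<^sup>+p. ennreal (Rq q p) * indicator (BCZ_triangle q) p \<partial>lborel)"
      by (intro nn_integral_mono)
    moreover have "?B \<in> sets lborel" by (simp add: borel_open open_Times)
    ultimately show ?thesis by simp
  qed
  ultimately show False using z by simp
qed

end

section \<open>Existence of the invariant measure\<close>

definition hitdom :: "nat \<Rightarrow> mat2 set" where
  "hitdom q = psi ` Yq q"

text \<open>First coordinates shrink by the factor n + 1, so that every coset eventually meets the
  strip. The successor makes \<open>dil 0\<close> the identity.\<close>

definition dil :: "nat \<Rightarrow> mat2" where
  "dil n = mat2 (1 / real (Suc n)) 0 0 (real (Suc n))"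

text \<open>Each coset is moved by the first dilation that brings it into \<open>hits q\<close>, and
  its representative there is moved back. This gives a domain for the whole quotient before
  \<open>hits q\<close> is known to have full measure.\<close>

definition fulldom :: "nat \<Rightarrow> mat2 set" where
  "fulldom q = {g \<in> SL2. \<exists>n. coset q (dil n ** g) \<in> hits q \<and>
     (\<forall>m<n. coset q (dil m ** g) \<notin> hits q) \<and> dil n ** g \<in> hitdom q}"

lemma Phi_psi: "Phi q y = coset q (psi y)"
  by (simp add: Phi_def psi_def)

lemma psi_SL2_iff: "psi y \<in> SL2 \<longleftrightarrow> fst (fst y) \<noteq> 0"
proof (cases y rule: prod.exhaust)
  case (Pair p s)
  then show ?thesis by (cases p) (auto simp: psi_eq SL2_iff field_simps)
qed

lemma psi_coords: "fst (fst y) \<noteq> 0 \<Longrightarrow> ((psi y $ 1 $ 1, psi y $ 1 $ 2), - psi y $ 2 $ 1 / psi y $ 1 $ 1) = y"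
  by (cases y; cases "fst y") (auto simp: psi_eq)

lemma coords_psi:
  assumes "g \<in> SL2" "g$1$1 \<noteq> 0" shows "psi ((g$1$1, g$1$2), - g$2$1 / g$1$1) = g"
  using assms by (simp add: psi_eq mat2_eq_iff SL2_iff field_simps)

lemma haar_indicator: "B \<in> sets borel \<Longrightarrow> haar (indicator B) = emeasure lborel (psi -` B)"
proof -
  assume B: "B \<in> sets borel"
  have "psi -` B \<in> sets lborel" using measurable_sets[OF measurable_psi B] by simp
  then have "emeasure lborel (psi -` B) = (\<integral>\<^sup>+y. indicator (psi -` B) y \<partial>lborel)" by simp
  then show ?thesis by (simp add: haar_def indicator_def)
qed

lemma dil_SL2: "dil n \<in> SL2" and dil_0: "dil 0 = mat 1"
  by (simp_all add: SL2_iff dil_def mat2_eq_iff)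

text \<open>Translating A by g amounts to translating the domain by the inverse of g. The result is
  again a fundamental domain, and the measure does not depend on the domain; this is the invariance
  of the quotient measure.\<close>

lemma haar_fundom_lmul:
  assumes D: "fundom q D" and g: "g \<in> SL2" and A: "A \<in> sets (Xq_space q)"
  shows "haar (indicator (preim q (lmul g ` A) \<inter> D)) = haar (indicator (preim q A \<inter> D))"
proof -
  have A': "A \<subseteq> Xq q" "preim q A \<in> sets borel" using A by (auto simp: sets_Xq)
  have D': "fundom q {h. g ** h \<in> D}" by (rule fundom_translate[OF g D])
  have "indicator (preim q (lmul g ` A) \<inter> D) = (\<lambda>h. indicator (preim q A \<inter> {h. g ** h \<in> D}) (minv g ** h) :: ennreal)"
    unfolding preim_lmul[OF g A'(1)] by (auto simp: indicator_def minv_cancel g)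
  then have "haar (indicator (preim q (lmul g ` A) \<inter> D)) = haar (\<lambda>h. indicator (preim q A \<inter> {h. g ** h \<in> D}) (minv g ** h))"
    by simp
  also have "\<dots> = haar (indicator (preim q A \<inter> {h. g ** h \<in> D}))"
    using A'(2) D' by (intro haar_left_invariant minv_SL2 g) (auto simp: fundom_def)
  also have "\<dots> = haar (indicator (preim q A \<inter> D))"
    by (rule haar_fundom_eq[OF D' D A'(2)])
  finally show ?thesis .
qed

context
  fixes q :: nat
  assumes q3: "q \<ge> 3"
begin

lemma Yq_pos: "y \<in> Yq q \<Longrightarrow> 0 < fst (fst y)"
  by (auto simp: Yq_def BCZ_triangle_def)

lemma hitdom_eq: "hitdom q = {g \<in> SL2. g$1$1 \<noteq> 0 \<and> ((g$1$1, g$1$2), - g$2$1 / g$1$1) \<in> Yq q}"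
proof (intro subset_antisym subsetI)
  fix g assume "g \<in> hitdom q"
  then obtain y where y: "y \<in> Yq q" "g = psi y" by (auto simp: hitdom_def)
  have n: "fst (fst y) \<noteq> 0" using Yq_pos[OF y(1)] by simp
  have "psi y $ 1 $ 1 = fst (fst y)" by (cases y; cases "fst y") (simp add: psi_eq)
  then show "g \<in> {g \<in> SL2. g$1$1 \<noteq> 0 \<and> ((g$1$1, g$1$2), - g$2$1 / g$1$1) \<in> Yq q}"
    using psi_coords[OF n] y n by (simp add: psi_SL2_iff)
next
  fix g assume "g \<in> {g \<in> SL2. g$1$1 \<noteq> 0 \<and> ((g$1$1, g$1$2), - g$2$1 / g$1$1) \<in> Yq q}"
  then show "g \<in> hitdom q" unfolding hitdom_def using coords_psi[of g] by (metis (mono_tags, lifting) image_eqI mem_Collect_eq)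
qed

lemma hitdom_borel [measurable]: "hitdom q \<in> sets borel"
proof -
  have "(\<lambda>g::mat2. ((g$1$1, g$1$2), - g$2$1 / g$1$1)) \<in> borel_measurable borel"
    by (intro measurable_Pair_borel) measurable
  from measurable_sets[OF this Yq_borel[OF q3]]
  have [measurable]: "{g::mat2. ((g$1$1, g$1$2), - g$2$1 / g$1$1) \<in> Yq q} \<in> sets borel" by (simp add: vimage_def)
  have "hitdom q = SL2 \<inter> {g \<in> space borel. g$1$1 \<noteq> 0} \<inter> {g::mat2. ((g$1$1, g$1$2), - g$2$1 / g$1$1) \<in> Yq q}"
    unfolding hitdom_eq by auto
  also have "\<dots> \<in> sets borel" by measurable
  finally show ?thesis .
qed

lemma psi_hitdom_iff: "psi y \<in> SL2 \<Longrightarrow> psi y \<in> hitdom q \<longleftrightarrow> y \<in> Yq q"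
proof
  assume S: "psi y \<in> SL2" and "psi y \<in> hitdom q"
  then show "y \<in> Yq q" unfolding hitdom_eq using psi_coords[of y] by (simp add: psi_SL2_iff)
qed (simp add: hitdom_def)

lemma hitdom_SL2: "hitdom q \<subseteq> SL2" unfolding hitdom_eq by auto

lemma hitdom_hits: "h \<in> hitdom q \<Longrightarrow> coset q h \<in> hits q"
  using Phi_hits[OF q3] by (auto simp: hitdom_def Phi_psi)

lemma hitdom_unique:
  assumes "coset q g \<in> hits q" shows "\<exists>!h. h \<in> coset q g \<and> h \<in> hitdom q"
proof -
  obtain y where y: "y \<in> Yq q" "Phi q y = coset q g"
    using Phi_bij[OF q3] assms unfolding bij_betw_def by (metis imageE)
  show ?thesis
  proof (rule ex1I[of _ "psi y"])
    show "psi y \<in> coset q g \<and> psi y \<in> hitdom q"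
      using y coset_self[of "psi y" q] by (simp add: hitdom_def Phi_psi)
    fix h assume h: "h \<in> coset q g \<and> h \<in> hitdom q"
    then obtain y' where y': "y' \<in> Yq q" "h = psi y'" by (auto simp: hitdom_def)
    have "Phi q y' = Phi q y" using coset_eqI[of h q g] h y y' by (simp add: Phi_psi)
    then have "y' = y" by (rule inj_onD[OF Phi_inj[OF q3]]) (use y y' in auto)
    then show "h = psi y" using y' by simp
  qed
qed

lemma hits_dil_iff:
  assumes g: "g \<in> SL2"
  shows "coset q (dil n ** g) \<in> hits q \<longleftrightarrow> (\<exists>\<gamma>\<in>Gq q. 0 < (g ** \<gamma>)$1$1 \<and> (g ** \<gamma>)$1$1 \<le> real (Suc n))"
proof -
  have e: "(dil n ** g ** \<gamma>)$1$1 = (g ** \<gamma>)$1$1 / real (Suc n)" for \<gamma> :: mat2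
    unfolding matrix_mul_assoc[symmetric] mult_nth[of "dil n" "g ** \<gamma>"] by (simp add: dil_def)
  have "coset q (dil n ** g) \<in> hits q \<longleftrightarrow> (\<exists>r. r \<in> slopes q (dil n ** g))"
    using coset_hits_iff[OF q3 SL2_mult[OF dil_SL2 g]] by auto
  also have "\<dots> \<longleftrightarrow> (\<exists>\<gamma>\<in>Gq q. 0 < (dil n ** g ** \<gamma>)$1$1 \<and> (dil n ** g ** \<gamma>)$1$1 \<le> 1)"
    unfolding slopes_iff coset_def by blast
  also have "\<dots> \<longleftrightarrow> (\<exists>\<gamma>\<in>Gq q. 0 < (g ** \<gamma>)$1$1 \<and> (g ** \<gamma>)$1$1 \<le> real (Suc n))"
    unfolding e by (simp add: zero_less_divide_iff divide_le_eq)
  finally show ?thesis .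
qed

lemma hits_dil_mono:
  "g \<in> SL2 \<Longrightarrow> m \<le> n \<Longrightarrow> coset q (dil m ** g) \<in> hits q \<Longrightarrow> coset q (dil n ** g) \<in> hits q"
  unfolding hits_dil_iff by force

lemma hits_dil_ex: assumes g: "g \<in> SL2" shows "\<exists>n. coset q (dil n ** g) \<in> hits q"
proof -
  \<comment> \<open>As the first row is nonzero, one of 1, -1, S, -S makes the upper left entry
    positive.\<close>
  have "g$1$1 \<noteq> 0 \<or> g$1$2 \<noteq> 0" using g by (auto simp: SL2_iff)
  then have "\<exists>\<gamma>\<in>Gq q. 0 < (g ** \<gamma>)$1$1"
  proof
    assume "g$1$1 \<noteq> 0"
    then have "0 < (g ** mat 1)$1$1 \<or> 0 < (g ** (- mat 1))$1$1" by (auto simp: mult_nth)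
    then show ?thesis using Gq.Gq_one[of q] Gq_uminus[OF Gq.Gq_one[of q]] by blast
  next
    assume "g$1$2 \<noteq> 0"
    then have "0 < (g ** Smat)$1$1 \<or> 0 < (g ** (- Smat))$1$1" by (auto simp: mult_nth Smat_def)
    then show ?thesis using Smat_Gq[of q] Gq_uminus[OF Smat_Gq[of q]] by blast
  qed
  then obtain \<gamma> where \<gamma>: "\<gamma> \<in> Gq q" "0 < (g ** \<gamma>)$1$1" by blast
  obtain n where "(g ** \<gamma>)$1$1 \<le> real n" using real_arch_simple by blast
  then have "(g ** \<gamma>)$1$1 \<le> real (Suc n)" by simp
  then show ?thesis unfolding hits_dil_iff[OF g] using \<gamma> by blast
qed

lemma hits_sets: "hits q \<in> sets (Xq_space q)"
proof -
  have "preim q (hits q) = SL2 \<inter> (\<Union>\<gamma>\<in>Gq q. {g. g ** \<gamma> \<in> {h. 0 < h$1$1 \<and> h$1$1 \<le> 1}})"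
    using hits_dil_iff[where n = 0] by (auto simp: preim_def dil_0)
  also have "\<dots> \<in> sets borel"
  proof -
    have "{h \<in> space borel. 0 < h$1$1 \<and> h$1$1 \<le> (1::real)} \<in> sets (borel :: mat2 measure)" by measurable
    then show ?thesis by (intro sets.Int SL2_borel sets.countable_UN'' countable_Gq measurable_Collect_mult) simp
  qed
  finally show ?thesis unfolding sets_Xq by (auto simp: hits_def[OF q3] Xq_def)
qed

lemma preim_hits_borel: "preim q (hits q) \<in> sets borel" and hits_Xq: "hits q \<subseteq> Xq q"
  using hits_sets by (auto simp: sets_Xq)

lemma dil_preim_iff: "dil n ** g \<in> preim q (hits q) \<longleftrightarrow> g \<in> SL2 \<and> coset q (dil n ** g) \<in> hits q"
  by (simp add: preim_def SL2_left_mult_iff dil_SL2)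

lemma fulldom_fundom: "fundom q (fulldom q)"
  unfolding fundom_def
proof (intro conjI ballI)
  let ?P = "\<lambda>n. {g. dil n ** g \<in> preim q (hits q)}"
  have "fulldom q = (\<Union>n. ?P n \<inter> {g. dil n ** g \<in> hitdom q} - (\<Union>m\<in>{..<n}. ?P m))"
    unfolding fulldom_def dil_preim_iff by auto
  also have "\<dots> \<in> sets borel"
    by (intro sets.countable_UN'' sets.Diff sets.Int measurable_Collect_mult preim_hits_borel hitdom_borel) auto
  finally show "fulldom q \<in> sets borel" .
  show "fulldom q \<subseteq> SL2" by (auto simp: fulldom_def)
  fix g assume g: "g \<in> SL2"
  define n where "n = (LEAST n. coset q (dil n ** g) \<in> hits q)"
  have n: "coset q (dil n ** g) \<in> hits q" unfolding n_def using hits_dil_ex[OF g] by (rule LeastI_ex)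
  have less: "coset q (dil m ** g) \<notin> hits q" if "m < n" for m using that not_less_Least n_def by blast
  have full: "h \<in> fulldom q \<longleftrightarrow> dil n ** h \<in> hitdom q" if h: "h \<in> coset q g" for h
  proof -
    have e: "coset q (dil m ** h) = coset q (dil m ** g)" for m
      using h by (intro coset_eqI) (simp add: coset_left_mult_iff dil_SL2)
    have "k = n" if "coset q (dil k ** g) \<in> hits q" "\<forall>m<k. coset q (dil m ** g) \<notin> hits q" for k
      using that n less by (meson linorder_neqE_nat)
    then show ?thesis unfolding fulldom_def mem_Collect_eq e using coset_SL2[OF g h] n less by blast
  qed
  obtain h where h: "h \<in> coset q (dil n ** g)" "h \<in> hitdom q"
    and u: "\<And>h'. h' \<in> coset q (dil n ** g) \<Longrightarrow> h' \<in> hitdom q \<Longrightarrow> h' = h"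
    using hitdom_unique[OF n] by blast
  show "\<exists>!h. h \<in> coset q g \<and> h \<in> fulldom q"
  proof (rule ex1I[of _ "minv (dil n) ** h"])
    have "minv (dil n) ** h \<in> coset q g"
      using h(1) coset_left_mult_iff[OF dil_SL2, of n "minv (dil n) ** h" q g] by (simp add: minv_cancel dil_SL2)
    then show "minv (dil n) ** h \<in> coset q g \<and> minv (dil n) ** h \<in> fulldom q"
      using h by (simp add: full minv_cancel dil_SL2)
    fix h' assume h': "h' \<in> coset q g \<and> h' \<in> fulldom q"
    then have "dil n ** h' = h" using full[of h'] u coset_left_mult_iff[OF dil_SL2] by blast
    then show "h' = minv (dil n) ** h" by (auto simp: minv_cancel dil_SL2)
  qed
qed

lemma fulldom_hits: "preim q (hits q) \<inter> fulldom q = hitdom q"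
proof (intro subset_antisym subsetI)
  fix g assume g: "g \<in> preim q (hits q) \<inter> fulldom q"
  then obtain n where n: "\<forall>m<n. coset q (dil m ** g) \<notin> hits q" "dil n ** g \<in> hitdom q" by (auto simp: fulldom_def)
  have "coset q (dil 0 ** g) \<in> hits q" using g by (simp add: preim_def dil_0)
  then have "n = 0" using n(1) by blast
  then show "g \<in> hitdom q" using n(2) by (simp add: dil_0)
next
  fix g assume g: "g \<in> hitdom q"
  then show "g \<in> preim q (hits q) \<inter> fulldom q"
    using hitdom_hits[OF g] hitdom_SL2 by (auto simp: preim_def fulldom_def dil_0 intro!: exI[of _ 0])
qed

text \<open>The preimages of \<open>hits\<close> under the dilations increase to the whole space, but invariance
  gives all of them the same finite measure; hence \<open>hits\<close> has full measure.\<close>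

lemma haar_fulldom: "haar (indicator (fulldom q)) = haar (indicator (hitdom q))"
proof -
  let ?A = "\<lambda>n. {g. dil n ** g \<in> preim q (hits q)} \<inter> fulldom q"
  have fb: "fulldom q \<in> sets borel" "fulldom q \<subseteq> SL2" using fulldom_fundom by (auto simp: fundom_def)
  have Ab: "?A n \<in> sets borel" for n
    by (intro sets.Int measurable_Collect_mult preim_hits_borel fb)
  \<comment> \<open>\<open>?A n\<close> is the part of the domain above the image of
    \<open>hits q\<close> under the inverse dilation, so invariance gives it the measure of the part
    above \<open>hits q\<close>, which is \<open>hitdom q\<close>.\<close>
  have A: "haar (indicator (?A n)) = haar (indicator (hitdom q))" for n
    using haar_fundom_lmul[OF fulldom_fundom minv_SL2[OF dil_SL2] hits_sets, of n]
    by (simp add: preim_lmul[OF minv_SL2[OF dil_SL2] hits_Xq] fulldom_hits)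
  have inc: "incseq (\<lambda>n. psi -` ?A n)"
    unfolding incseq_def dil_preim_iff using hits_dil_mono by auto
  have un: "(\<Union>n. ?A n) = fulldom q"
    unfolding dil_preim_iff using hits_dil_ex fb(2) by auto
  have "haar (indicator (fulldom q)) = emeasure lborel (\<Union>n. psi -` ?A n)"
    unfolding haar_indicator[OF fb(1)] by (subst un[symmetric]) (simp add: vimage_UN)
  also have "\<dots> = (SUP n. emeasure lborel (psi -` ?A n))"
    using measurable_sets[OF measurable_psi Ab] by (intro SUP_emeasure_incseq[symmetric] inc) auto
  finally show ?thesis unfolding haar_indicator[OF Ab, symmetric] A by simp
qed

lemma haar_hitdom: "haar (indicator (hitdom q)) = (\<integral>\<^sup>+p. ennreal (Rq q p) * indicator (BCZ_triangle q) p \<partial>lborel)"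
proof -
  have "haar (indicator (hitdom q)) = (\<integral>\<^sup>+y. indicator (Yq q) y \<partial>lborel)"
    unfolding haar_def using AE_psi_SL2
    by (intro nn_integral_cong_AE) (auto elim!: eventually_mono simp: psi_hitdom_iff indicator_def)
  also have "\<dots> = (\<integral>\<^sup>+p. \<integral>\<^sup>+s. indicator (Yq q) (p, s) \<partial>lborel \<partial>lborel)"
    using Yq_borel[OF q3] by (intro nn_integral_lborel_pair) simp
  also have "\<dots> = (\<integral>\<^sup>+p. ennreal (Rq q p) * indicator (BCZ_triangle q) p \<partial>lborel)"
  proof (rule nn_integral_cong)
    fix p :: "real \<times> real"
    show "(\<integral>\<^sup>+s. indicator (Yq q) (p, s) \<partial>lborel) = ennreal (Rq q p) * indicator (BCZ_triangle q) p"
    proof (cases "p \<in> BCZ_triangle q")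
      case True
      then have "(\<lambda>s. indicator (Yq q) (p, s) :: ennreal) = indicator {0..<Rq q p}"
        by (auto simp: Yq_def indicator_def)
      then show ?thesis using True Rq_props(2)[OF q3 True] by simp
    next
      case False
      then have "(\<lambda>s. indicator (Yq q) (p, s) :: ennreal) = (\<lambda>s. 0)"
        by (auto simp: Yq_def indicator_def)
      then show ?thesis using False by simp
    qed
  qed
  finally show ?thesis .
qed

section \<open>Integrability, normalization and the push-forward measure\<close>

lemma Rq_integrable: "integrable (mq q) (Rq q)"
  and mqR_eq: "ennreal (mqR q) = ennreal (2 / lambda_q q) * haar (indicator (hitdom q))"
proof -
  note [measurable] = measurable_Rq[OF q3] triangle_borel[OF q3]
  have l: "0 < lambda_q q" using lambda_ge_1[OF q3] by simp
  have I: "(\<integral>\<^sup>+p. ennreal (Rq q p) \<partial>mq q) = ennreal (2 / lambda_q q) * haar (indicator (hitdom q))"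
    unfolding mq_def haar_hitdom
    by (subst nn_integral_density, measurable)
      (simp add: nn_integral_cmult[symmetric] mult_ac)
  have pos: "AE p in mq q. 0 \<le> Rq q p"
    unfolding mq_def using Rq_props(2)[OF q3]
    by (subst AE_density, measurable) (auto simp: indicator_def intro!: AE_I2 order.trans[OF zero_le_one])
  have "(\<integral>\<^sup>+p. ennreal (norm (Rq q p)) \<partial>mq q) = (\<integral>\<^sup>+p. ennreal (Rq q p) \<partial>mq q)"
    using pos by (intro nn_integral_cong_AE) auto
  also have "\<dots> < \<infinity>"
    unfolding I haar_hitdom using Rq_nn_integral_finite[OF q3] by (simp add: ennreal_mult_less_top)
  finally show int: "integrable (mq q) (Rq q)"
    by (intro integrableI_bounded) (simp_all add: mq_def)
  show "ennreal (mqR q) = ennreal (2 / lambda_q q) * haar (indicator (hitdom q))"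
    unfolding mqR_def I[symmetric] by (rule nn_integral_eq_integral[OF int pos, symmetric])
qed

lemma nu_normalized: "ennreal (2 / (lambda_q q * mqR q)) * haar (indicator (hitdom q)) = 1"
proof -
  have l: "0 < lambda_q q" using lambda_ge_1[OF q3] by simp
  obtain N where N: "haar (indicator (hitdom q)) = ennreal N" "0 \<le> N"
    using Rq_nn_integral_finite[OF q3] unfolding haar_hitdom
    by (metis ennreal_cases infinity_ennreal_def less_irrefl)
  have "N \<noteq> 0" using N Rq_nn_integral_pos[OF q3] unfolding haar_hitdom by auto
  have "ennreal (mqR q) = ennreal (2 / lambda_q q * N)"
    unfolding mqR_eq N(1) using N l by (intro ennreal_mult[symmetric]) auto
  moreover have "0 < 2 / lambda_q q * N" using N l \<open>N \<noteq> 0\<close> by simp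
  \<comment> \<open>\<open>ennreal\<close> sends all negative reals to 0; positivity of the
    right-hand side allows it to be cancelled.\<close>
  ultimately have "mqR q = 2 / lambda_q q * N"
    by (metis ennreal_eq_0_iff ennreal_inj less_eq_real_def linorder_not_le)
  then have "2 / (lambda_q q * mqR q) = 1 / N" using l by simp
  then show ?thesis using N \<open>N \<noteq> 0\<close> by (simp add: ennreal_mult[symmetric])
qed

text \<open>On the null set where the upper left entry vanishes, \<open>Phi\<close> takes values outside of \<open>Xq\<close>;
  so it is not a measurable map in the strict sense, and has to be modified there.\<close>

lemma emeasure_distr_nu:
  assumes A: "A \<in> sets (Xq_space q)"
  shows "emeasure (distr (nu_q q) (Xq_space q) (Phi q)) A =
     ennreal (2 / (lambda_q q * mqR q)) * haar (indicator (preim q A \<inter> hitdom q))"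
proof -
  note [measurable] = Yq_borel[OF q3]
  define \<Phi> where "\<Phi> y = (if psi y \<in> SL2 then coset q (psi y) else coset q (mat 1))" for y
  have sn: "sets (nu_q q) = sets borel" "space (nu_q q) = UNIV" by (simp_all add: nu_q_def)
  have psi_preim: "psi -` preim q B \<in> sets borel" if "B \<in> sets (Xq_space q)" for B
    using measurable_sets[OF measurable_psi, of "preim q B"] that by (simp add: sets_Xq)
  have psi_SL2: "psi -` SL2 \<in> sets borel"
    using measurable_sets[OF measurable_psi SL2_borel] by simp
  have vim: "\<Phi> -` B = (if coset q (mat 1) \<in> B then psi -` preim q B \<union> - (psi -` SL2) else psi -` preim q B)" for B
    by (auto simp: \<Phi>_def preim_def split: if_splits)
  have meas: "\<Phi> \<in> measurable (nu_q q) (Xq_space q)"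
  proof (rule measurableI)
    show "\<Phi> y \<in> space (Xq_space q)" for y by (auto simp: \<Phi>_def space_Xq Xq_def SL2_one)
    fix B assume "B \<in> sets (Xq_space q)"
    then show "\<Phi> -` B \<inter> space (nu_q q) \<in> sets (nu_q q)"
      unfolding vim sn using psi_preim psi_SL2 by auto
  qed
  have AE: "AE y in nu_q q. psi y \<in> SL2"
    unfolding nu_q_def using AE_psi_SL2 by (subst AE_density) auto
  \<comment> \<open>A matrix belongs to its own coset, so the coset of a matrix outside
    \<open>SL2\<close> is no point of \<open>Xq q\<close>. Preimages of measurable sets under
    \<open>Phi q\<close> thus avoid the exceptional null set.\<close>
  have vimP: "Phi q -` B = psi -` preim q B" if "B \<in> sets (Xq_space q)" for B
  proof -
    have "psi y \<in> SL2" if "coset q (psi y) \<in> Xq q" for y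
      using that coset_self[of "psi y" q] by (auto elim!: Xq_cases intro: coset_SL2)
    then show ?thesis using that by (auto simp: Phi_psi preim_def sets_Xq)
  qed
  have eq: "emeasure (nu_q q) (Phi q -` B \<inter> space (nu_q q)) = emeasure (nu_q q) (\<Phi> -` B \<inter> space (nu_q q))"
    if B: "B \<in> sets (Xq_space q)" for B
  proof (rule emeasure_eq_AE)
    show "AE y in nu_q q. (y \<in> Phi q -` B \<inter> space (nu_q q)) = (y \<in> \<Phi> -` B \<inter> space (nu_q q))"
      using AE by eventually_elim (simp add: Phi_psi \<Phi>_def)
    show "Phi q -` B \<inter> space (nu_q q) \<in> sets (nu_q q)" unfolding vimP[OF B] sn using psi_preim[OF B] by simp
    show "\<Phi> -` B \<inter> space (nu_q q) \<in> sets (nu_q q)" by (rule measurable_sets[OF meas B])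
  qed
  \<comment> \<open>\<open>distr\<close> is built from the measures of preimages alone, and these
    agree for the two maps.\<close>
  have "distr (nu_q q) (Xq_space q) (Phi q) = distr (nu_q q) (Xq_space q) \<Phi>"
    unfolding distr_def
    by (rule measure_of_eq[OF sets.space_closed]) (simp only: sets.sigma_sets_eq eq)
  then have "emeasure (distr (nu_q q) (Xq_space q) (Phi q)) A = emeasure (nu_q q) (Phi q -` A)"
    using emeasure_distr[OF meas A] eq[OF A] sn by simp
  also have "\<dots> = (\<integral>\<^sup>+y. ennreal (2 / (lambda_q q * mqR q)) * indicator (Yq q) y * indicator (psi -` preim q A) y \<partial>lborel)"
    unfolding vimP[OF A] nu_q_def using psi_preim[OF A] by (subst emeasure_density) auto
  also have "\<dots> = (\<integral>\<^sup>+y. ennreal (2 / (lambda_q q * mqR q)) * indicator (preim q A \<inter> hitdom q) (psi y) \<partial>lborel)"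
    using AE_psi_SL2 by (intro nn_integral_cong_AE) (auto elim!: eventually_mono simp: psi_hitdom_iff indicator_def)
  also have "\<dots> = ennreal (2 / (lambda_q q * mqR q)) * haar (indicator (preim q A \<inter> hitdom q))"
  proof -
    have "preim q A \<inter> hitdom q \<in> sets borel" using A hitdom_borel by (auto simp: sets_Xq)
    then have "(\<lambda>y. indicator (preim q A \<inter> hitdom q) (psi y) :: ennreal) \<in> borel_measurable lborel"
      using measurable_compose[OF measurable_psi borel_measurable_indicator] by simp
    then show ?thesis unfolding haar_def by (rule nn_integral_cmult)
  qed
  finally show ?thesis .
qed

text \<open>Invariance is available for fundamental domains of the whole quotient.
  \<open>hitdom q\<close> may be enlarged to \<open>fulldom q\<close> because the two have the same
  finite measure, so their difference is null.\<close>

lemma emeasure_distr_nu_fulldom: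
  assumes A: "A \<in> sets (Xq_space q)"
  shows "emeasure (distr (nu_q q) (Xq_space q) (Phi q)) A =
     ennreal (2 / (lambda_q q * mqR q)) * haar (indicator (preim q A \<inter> fulldom q))"
proof -
  have b: "fulldom q \<in> sets borel" "hitdom q \<in> sets borel" "preim q A \<in> sets borel"
    using fulldom_fundom hitdom_borel A by (auto simp: fundom_def sets_Xq)
  have sub: "hitdom q \<subseteq> fulldom q" using fulldom_hits by blast
  let ?M = "lborel :: ((real \<times> real) \<times> real) measure"
  have v: "psi -` B \<in> sets borel" if "B \<in> sets borel" for B
    using measurable_sets[OF measurable_psi that] by simp
  have "emeasure ?M (psi -` hitdom q) = emeasure ?M (psi -` fulldom q)" "emeasure ?M (psi -` hitdom q) < \<infinity>"
    using haar_fulldom haar_indicator[OF b(1)] haar_indicator[OF b(2)] haar_hitdom Rq_nn_integral_finite[OF q3] by auto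
  then have "emeasure ?M (psi -` fulldom q - psi -` hitdom q) = 0"
    using sub by (subst emeasure_Diff) (auto simp: v b)
  then have "AE y in ?M. y \<notin> psi -` fulldom q - psi -` hitdom q"
    by (intro AE_not_in null_setsI) (auto simp: v b)
  then have "haar (indicator (preim q A \<inter> fulldom q)) = haar (indicator (preim q A \<inter> hitdom q))"
    unfolding haar_def using sub by (intro nn_integral_cong_AE) (auto elim!: eventually_mono simp: indicator_def)
  then show ?thesis using emeasure_distr_nu[OF A] by simp
qed

text \<open>The push-forward has the properties in the description of \<open>mu_q\<close>, and
  uniqueness makes the description denote it.\<close>

lemma mu_q_eq: "distr (nu_q q) (Xq_space q) (Phi q) = mu_q q"
proof -
  let ?\<mu> = "distr (nu_q q) (Xq_space q) (Phi q)"
  have sets: "sets ?\<mu> = sets (Xq_space q)" by simp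
  have whole: "Xq q \<in> sets (Xq_space q)" using sets.top[of "Xq_space q"] by (simp add: space_Xq)
  have "preim q (Xq q) \<inter> hitdom q = hitdom q" using hitdom_SL2 by (auto simp: preim_def Xq_def)
  then have "emeasure ?\<mu> (space ?\<mu>) = 1"
    using emeasure_distr_nu[OF whole] nu_normalized by (simp add: space_Xq)
  then have prob: "prob_space ?\<mu>" by (rule prob_spaceI)
  have inv: "\<forall>g\<in>SL2. \<forall>A\<in>sets ?\<mu>. emeasure ?\<mu> (lmul g ` A) = emeasure ?\<mu> A"
    using emeasure_distr_nu_fulldom sets_lmul_image haar_fundom_lmul[OF fulldom_fundom] by auto
  have D: "haar (indicator (fulldom q)) \<noteq> 0" "haar (indicator (fulldom q)) \<noteq> \<infinity>"
    unfolding haar_fulldom haar_hitdom using Rq_nn_integral_finite[OF q3] Rq_nn_integral_pos[OF q3] by auto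
  show ?thesis unfolding mu_q_def
    by (rule the_equality[symmetric])
      (use sets prob inv invariant_measure_unique[OF fulldom_fundom D] in auto)
qed

lemma emeasure_hits: "emeasure (mu_q q) (hits q) = 1"
proof -
  have "preim q (hits q) \<inter> hitdom q = hitdom q" using fulldom_hits by auto
  then show ?thesis
    unfolding mu_q_eq[symmetric] using emeasure_distr_nu[OF hits_sets] nu_normalized by simp
qed

end

theorem mainTheorem9:
  fixes q :: nat
  assumes "q \<ge> 3"
  shows "integrable (mq q) (Rq q)
    \<and> (\<exists>E. E \<subseteq> Xq q \<and> (\<forall>t. hflow t ` E = E) \<and> E \<in> sets (mu_q q)
          \<and> emeasure (mu_q q) E = 1 \<and> bij_betw (Phi q) (Yq q) E)
    \<and> (\<forall>t\<ge>0. \<forall>y\<in>Yq q. Phi q (susp_flow q t y) = hflow t (Phi q y))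
    \<and> distr (nu_q q) (Xq_space q) (Phi q) = mu_q q"
proof (intro conjI exI[of _ "hits q"] allI impI ballI)
  show "hits q \<in> sets (mu_q q)"
    unfolding mu_q_eq[OF assms, symmetric] using hits_sets[OF assms] by simp
qed (use assms Rq_integrable hits_Xq hflow_hits emeasure_hits Phi_bij susp_flow_conj mu_q_eq in auto)

end
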